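(* Let $d,d'\ge0$ with $d+d'\ge1$, and let $f=(f_1,\dots,f_{d+d'}):\Delta_N\to\mathbb{C}^d\oplus\mathbb{R}^{d'}$ be an affine map. Let $G=\mathbb{Z}_{r_1}\oplus\cdots\oplus\mathbb{Z}_{r_k}$, $r_i\ge2$, and let $r=r_1\cdots r_k$. For each $1\le i\le d+d'$, let $S_i\subseteq G\setminus\{0\}$ and $m_i=|S_i|$. For each $d+1\le i\le d+d'$, let $T_i=\{h\in S_i: |h|=2\}$ and $m_i'=|T_i|$, and suppose that $-h\notin S_i$ whenever $h\in S_i\setminus T_i$. Let $m=\sum_{i=1}^{d+d'}m_i$ and $m'=\sum_{i=d+1}^{d+d'}m_i'$. If $N=2m-m'+r-1$, then there exists some $\{x_g\}_{g\in G}\subset\Delta_N$ with pairwise disjoint support such that $c_{i,h}=0$ for all $h\in S_i$ and all $1\le i\le d+d'$. Moreover, if $N<2m-m'+r-1$, then for almost any affine map $f:\Delta_N\to\mathbb{C}^d\oplus\mathbb{R}^{d'}$ there does not exist $\{x_g\}_{g\in G}\subset\Delta_N$ with pairwise disjoint support such that $c_{i,h}=0$ for all $h\in S_i$ and all $1\le i\le d+d'$.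
   Context: $\Delta_N$ is the $N$-simplex; $|h|$ is the order of $h\in G$. A collection $\{x_g\}_{g\in G}\subset\Delta_N$ has pairwise disjoint support if there are pairwise disjoint faces $\sigma_g$ of $\Delta_N$ with $x_g\in\sigma_g$ for all $g\in G$. For $g,h\in G$ let $\chi_h(g)=\prod_{j=1}^k\zeta_{r_j}^{h_jg_j}$ with $\zeta_q=e^{2\pi i/q}$. The Fourier coefficients determined by $f$ and $\{x_g\}_{g\in G}$ are $$c_{i,h}=\frac1{|G|}\sum_{g\in G}f_i(x_g)\,\chi_h(g)^{-1},\qquad h\in G,\ 1\le i\le d+d'.$$ "Almost any affine map" means: for Lebesgue-almost every choice of the images of the $N+1$ vertices of $\Delta_N$. *)

theory Defs
  imports "HOL-Analysis.Analysis" "HOL-Homology.Simplices"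
    "HOL-Algebra.Multiplicative_Group"
begin

text \<open>
  The simplex \<open>\<Delta>\<^sub>N\<close> is the library's \<^const>\<open>standard_simplex\<close>: points are their
  barycentric coordinate vectors, supported on \<open>{..N}\<close>.
\<close>

definition vertex :: "nat \<Rightarrow> nat \<Rightarrow> real" where
  "vertex j = (\<lambda>i. if i = j then 1 else 0)"

definition face_of_simplex :: "nat \<Rightarrow> (nat \<Rightarrow> real) set \<Rightarrow> bool" where
  "face_of_simplex N \<sigma> \<longleftrightarrow>
     (\<exists>A\<subseteq>{..N}. \<sigma> = {x \<in> standard_simplex N. \<forall>i. i \<notin> A \<longrightarrow> x i = 0})"

definition pairwise_disjoint_support ::
    "nat \<Rightarrow> 'g set \<Rightarrow> ('g \<Rightarrow> nat \<Rightarrow> real) \<Rightarrow> bool" where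
  "pairwise_disjoint_support N I x \<longleftrightarrow>
     (\<exists>\<sigma>. (\<forall>g\<in>I. face_of_simplex N (\<sigma> g) \<and> x g \<in> \<sigma> g) \<and> disjoint_family_on \<sigma> I)"

text \<open>
  \<open>\<complex>\<^sup>d \<oplus> \<real>\<^sup>d'\<close>, with complex coordinates indexed by \<open>1, \<dots>, d\<close> and real coordinates
  by \<open>d + 1, \<dots>, d + d'\<close>. This allows \<open>d = 0\<close> or \<open>d' = 0\<close>.
\<close>

type_synonym cvec_rvec = "(nat \<Rightarrow> complex) \<times> (nat \<Rightarrow> real)"

definition target_space :: "nat \<Rightarrow> nat \<Rightarrow> cvec_rvec set" where
  "target_space d d' = ({1..d} \<rightarrow>\<^sub>E UNIV) \<times> ({d+1..d+d'} \<rightarrow>\<^sub>E UNIV)"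

definition coord :: "nat \<Rightarrow> nat \<Rightarrow> cvec_rvec \<Rightarrow> complex" where
  "coord d i y = (if i \<le> d then fst y i else complex_of_real (snd y i))"

text \<open>
  Affinity is stated coordinatewise since \<^typ>\<open>cvec_rvec\<close> carries no vector space instance.
\<close>

definition affine_map ::
    "nat \<Rightarrow> nat \<Rightarrow> nat \<Rightarrow> ((nat \<Rightarrow> real) \<Rightarrow> cvec_rvec) \<Rightarrow> bool" where
  "affine_map N d d' f \<longleftrightarrow>
     f \<in> standard_simplex N \<rightarrow> target_space d d' \<and>
     (\<forall>x\<in>standard_simplex N. \<forall>y\<in>standard_simplex N. \<forall>t\<in>{0..1}. \<forall>i\<in>{1..d+d'}.
        coord d i (f (\<lambda>j. (1 - t) * x j + t * y j)) =
        complex_of_real (1 - t) * coord d i (f x) + complex_of_real t * coord d i (f y))"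

text \<open>
  Lebesgue measure on \<open>\<complex>\<^sup>d \<oplus> \<real>\<^sup>d'\<close> and on the space \<open>(\<complex>\<^sup>d \<oplus> \<real>\<^sup>d')\<^sup>N\<^sup>+\<^sup>1\<close> of vertex images.
  Taking Borel rather than completed measures does not affect ``almost every'', because \<open>AE\<close>
  only asks the exceptional set to be contained in a measurable null set.
\<close>

definition target_measure :: "nat \<Rightarrow> nat \<Rightarrow> cvec_rvec measure" where
  "target_measure d d' =
     (\<Pi>\<^sub>M i\<in>{1..d}. (lborel :: complex measure)) \<Otimes>\<^sub>M
     (\<Pi>\<^sub>M i\<in>{d+1..d+d'}. (lborel :: real measure))"

definition vertex_images_measure ::
    "nat \<Rightarrow> nat \<Rightarrow> nat \<Rightarrow> (nat \<Rightarrow> cvec_rvec) measure" where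
  "vertex_images_measure N d d' = (\<Pi>\<^sub>M j\<in>{..N}. target_measure d d')"

definition for_almost_any_affine_map ::
    "nat \<Rightarrow> nat \<Rightarrow> nat \<Rightarrow> (((nat \<Rightarrow> real) \<Rightarrow> cvec_rvec) \<Rightarrow> bool) \<Rightarrow> bool" where
  "for_almost_any_affine_map N d d' P \<longleftrightarrow>
     (AE v in vertex_images_measure N d d'.
        \<forall>f. affine_map N d d' f \<and> (\<forall>j\<le>N. f (vertex j) = v j) \<longrightarrow> P f)"

text \<open>
  Every choice of vertex images is realised by an affine map, so the inner quantifier in
  \<^const>\<open>for_almost_any_affine_map\<close> is never vacuous.
\<close>

lemma space_vertex_images_measure:
  "space (vertex_images_measure N d d') = ({..N} \<rightarrow>\<^sub>E target_space d d')"
  by (simp add: vertex_images_measure_def target_measure_def target_space_def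
      space_PiM space_pair_measure)

lemma affine_map_with_vertex_images:
  assumes v: "v \<in> {..N} \<rightarrow>\<^sub>E target_space d d'"
  shows "\<exists>f. affine_map N d d' f \<and> (\<forall>j\<le>N. f (vertex j) = v j)"
proof -
  define f :: "(nat \<Rightarrow> real) \<Rightarrow> cvec_rvec" where
    "f x = (\<lambda>i\<in>{1..d}. \<Sum>j\<le>N. complex_of_real (x j) * fst (v j) i,
            \<lambda>i\<in>{d+1..d+d'}. \<Sum>j\<le>N. x j * snd (v j) i)" for x
  have "affine_map N d d' f"
    by (auto simp: affine_map_def target_space_def f_def coord_def algebra_simps
        sum.distrib sum_distrib_left sum_subtractf)
  moreover have "f (vertex j) = v j" if "j \<le> N" for j
  proof (rule prod_eqI)
    have vj: "fst (v j) \<in> {1..d} \<rightarrow>\<^sub>E UNIV" "snd (v j) \<in> {d+1..d+d'} \<rightarrow>\<^sub>E UNIV"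
      using PiE_mem[OF v, of j] that by (auto simp: target_space_def mem_Times_iff)
    show "fst (f (vertex j)) = fst (v j)"
      using that PiE_arb[OF vj(1)]
      by (auto simp: f_def vertex_def fun_eq_iff restrict_def if_distrib if_distribR sum.delta
          cong: if_cong)
    show "snd (f (vertex j)) = snd (v j)"
      using that PiE_arb[OF vj(2)]
      by (auto simp: f_def vertex_def fun_eq_iff restrict_def if_distrib if_distribR sum.delta
          cong: if_cong)
  qed
  ultimately show ?thesis by blast
qed

text \<open>
  \<open>\<int>\<^bsub>r\<^sub>1\<^esub> \<oplus> \<dots> \<oplus> \<int>\<^bsub>r\<^sub>k\<^esub>\<close>, written multiplicatively as in HOL-Algebra: the zero element is
  \<open>\<one>\<close> and \<open>-h\<close> is \<open>inv h\<close>. Residues are represented by the integers \<open>0, \<dots>, r\<^sub>j - 1\<close>.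
\<close>

definition cyclic_sum :: "nat \<Rightarrow> (nat \<Rightarrow> nat) \<Rightarrow> (nat \<Rightarrow> int) monoid" where
  "cyclic_sum k r = product_group {1..k} (\<lambda>j. integer_mod_group (r j))"

definition zeta :: "nat \<Rightarrow> complex" where
  "zeta q = exp (2 * of_real pi * \<i> / of_nat q)"

definition chi :: "nat \<Rightarrow> (nat \<Rightarrow> nat) \<Rightarrow> (nat \<Rightarrow> int) \<Rightarrow> (nat \<Rightarrow> int) \<Rightarrow> complex" where
  "chi k r h g = (\<Prod>j=1..k. zeta (r j) powi (h j * g j))"

definition fourier_coeff ::
    "nat \<Rightarrow> nat \<Rightarrow> (nat \<Rightarrow> nat) \<Rightarrow> ((nat \<Rightarrow> real) \<Rightarrow> cvec_rvec) \<Rightarrow>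
     ((nat \<Rightarrow> int) \<Rightarrow> nat \<Rightarrow> real) \<Rightarrow> nat \<Rightarrow> (nat \<Rightarrow> int) \<Rightarrow> complex" where
  "fourier_coeff d k r f x i h =
     1 / of_nat (card (carrier (cyclic_sum k r))) *
     (\<Sum>g\<in>carrier (cyclic_sum k r). coord d i (f (x g)) * inverse (chi k r h g))"

end

theory Submission
  imports Defs
begin

text \<open>
  Colour vertex \<open>j\<close> by the \<open>g\<close> whose point \<open>x\<^sub>g\<close> it supports. The average \<open>l\<close> of the \<open>x\<^sub>g\<close> then has mass
  \<open>1/r\<close> on each colour class and satisfies \<open>2m - m'\<close> real linear equations, the coefficients
  of vertex \<open>j\<close> depending on its colour. When \<open>N = 2m - m' + r - 1\<close>, the coefficient vectors of a
  vertex sum to zero over all colours, so the colourful Caratheodory theorem in dimension \<open>N\<close>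
  yields a colouring with a solution \<open>l\<close> (Sarkaria's tensor trick).

  When \<open>N\<close> is smaller, fix a colouring. Translating the images of each colour class along a
  suitable polynomial curve, only finitely many parameters admit a solution; as translations
  preserve Lebesgue measure, Fubini's theorem shows that the vertex images admitting a solution
  form a null set. There are finitely many colourings.
\<close>

subsection \<open>The colourful Caratheodory theorem\<close>

text \<open>The number 2m - m' + r - 1 counts real equations. Each complex equation is two real
  ones, except that a real coordinate with a character of order 2 gives only one; of the r mass
  equations, one follows from total mass 1. N + 1 vertices in colourful Caratheodory can absorb
  exactly N equations. The coefficient vectors sum to zero over the colours because a nontrivial
  character has zero sum over G, and the mass coefficients are centred by hand.

  For sharpness a count is not enough, as the equations might be dependent. In a real coordinate the
  coefficients at h and -h are conjugate, and the condition on -h removes this redundancy. A second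
  obstacle is that the relation among the equations varies with the vertex images, whereas Fubini
  needs translations chosen independently of them. A curve with a different monomial in every real
  coordinate meets each affine hyperplane in finitely many parameters, so one curve serves all
  relations at once.\<close>

lemma homogeneous_system_nontrivial_solution:
  fixes A :: "'i \<Rightarrow> 'j \<Rightarrow> 'a::field"
  assumes "finite I" "finite J" "card I < card J"
  obtains x where "\<exists>j\<in>J. x j \<noteq> 0" "\<And>i. i \<in> I \<Longrightarrow> (\<Sum>j\<in>J. A i j * x j) = 0"
proof -
  have "\<exists>x. (\<exists>j\<in>J. x j \<noteq> 0) \<and> (\<forall>i\<in>I. (\<Sum>j\<in>J. A i j * x j) = 0)"
    using assms
  proof (induction I arbitrary: J A rule: finite_induct)
    case empty
    then obtain j where "j \<in> J" by (metis card.empty card_gt_0_iff ex_in_conv)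
    then show ?case by (intro exI[of _ "\<lambda>_. 1"]) auto
  next
    case (insert i0 I)
    show ?case
    proof (cases "\<forall>j\<in>J. A i0 j = 0")
      case True
      from insert obtain x where "\<exists>j\<in>J. x j \<noteq> 0" "\<forall>i\<in>I. (\<Sum>j\<in>J. A i j * x j) = 0"
        by (metis card_insert_disjoint less_Suc_eq less_trans)
      with True show ?thesis by (intro exI[of _ x]) simp
    next
      case False
      then obtain j0 where j0: "j0 \<in> J" "A i0 j0 \<noteq> 0" by blast
      \<comment> \<open>Gaussian elimination: row \<open>i0\<close> serves as pivot row and removes
        the unknown \<open>j0\<close> from the other rows. Its value is restored in \<open>y\<close>
        by solving row \<open>i0\<close>.\<close>
      define A' where "A' i j = A i j - A i j0 * A i0 j / A i0 j0" for i j
      have "card I < card (J - {j0})"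
        using insert.prems insert.hyps j0 by simp
      with insert.IH[of "J - {j0}" A'] insert.prems obtain x
        where x: "\<exists>j\<in>J - {j0}. x j \<noteq> 0" "\<forall>i\<in>I. (\<Sum>j\<in>J - {j0}. A' i j * x j) = 0"
        by auto
      define s where "s = (\<Sum>j\<in>J - {j0}. A i0 j * x j)"
      define y where "y = x(j0 := - s / A i0 j0)"
      have split: "(\<Sum>j\<in>J. A i j * y j) = A i j0 * y j0 + (\<Sum>j\<in>J - {j0}. A i j * x j)" for i
        using insert.prems(1) j0(1) by (auto simp: sum.remove y_def)
      have "(\<Sum>j\<in>J. A i j * y j) = 0" if "i \<in> I" for i
      proof -
        have "0 = (\<Sum>j\<in>J - {j0}. A i j * x j - A i j0 / A i0 j0 * (A i0 j * x j))"
          using x(2) that by (simp add: A'_def left_diff_distrib mult.assoc)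
        also have "\<dots> = (\<Sum>j\<in>J - {j0}. A i j * x j) - A i j0 / A i0 j0 * s"
          by (simp add: sum_subtractf sum_distrib_left s_def)
        finally show ?thesis unfolding split by (simp add: y_def)
      qed
      moreover have "(\<Sum>j\<in>J. A i0 j * y j) = 0"
        unfolding split using j0(2) by (simp add: y_def s_def)
      moreover have "\<exists>j\<in>J. y j \<noteq> 0"
        using x(1) by (auto simp: y_def)
      ultimately show ?thesis by blast
    qed
  qed
  with that show ?thesis by blast
qed

section \<open>The standard simplex and first-order conditions for a least norm\<close>

lemma vertex_in_standard_simplex: "j \<le> N \<Longrightarrow> vertex j \<in> standard_simplex N"
  by (simp add: vertex_def)

lemma sum_mult_vertex:
  fixes b :: "nat \<Rightarrow> real"
  assumes "j \<le> N" shows "(\<Sum>i\<le>N. vertex j i * b i) = b j"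
  using assms by (simp add: vertex_def if_distrib[of "\<lambda>u. u * _"] sum.delta cong: if_cong)

lemma standard_simplexI:
  assumes "\<And>j. 0 \<le> x j" "\<And>j. j > N \<Longrightarrow> x j = 0" "(\<Sum>j\<le>N. x j) = 1"
  shows "x \<in> standard_simplex N"
proof -
  have "x j \<le> 1" for j
  proof (cases "j \<le> N")
    case True
    then show ?thesis using member_le_sum[of j "{..N}" x] assms by simp
  qed (use assms in auto)
  with assms show ?thesis by (simp add: standard_simplex_def)
qed

lemma compact_standard_simplex: "compact (standard_simplex N)"
  using compactin_standard_simplex[of N] by (simp add: euclidean_product_topology)

text \<open>The squared norm along the segment from \<open>p\<close> to \<open>b\<close> has
  derivative 2 \<open>u\<close> at t = 0. If \<open>u\<close> were negative, a short move towards
  \<open>b\<close> would lower the norm.\<close>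

lemma first_order_minimality:
  fixes p b :: "'i \<Rightarrow> real"
  assumes "\<And>t. 0 < t \<Longrightarrow> t \<le> 1 \<Longrightarrow>
      (\<Sum>k\<in>I. (p k)\<^sup>2) \<le> (\<Sum>k\<in>I. ((1 - t) * p k + t * b k)\<^sup>2)"
  shows "(\<Sum>k\<in>I. (p k)\<^sup>2) \<le> (\<Sum>k\<in>I. p k * b k)"
proof (rule ccontr)
  define u where "u = (\<Sum>k\<in>I. p k * b k) - (\<Sum>k\<in>I. (p k)\<^sup>2)"
  define w where "w = (\<Sum>k\<in>I. (b k - p k)\<^sup>2)"
  assume "\<not> ?thesis"
  then have u: "u < 0" by (simp add: u_def)
  have w: "w \<ge> 0" by (simp add: w_def sum_nonneg)
  have exp: "(\<Sum>k\<in>I. ((1 - t) * p k + t * b k)\<^sup>2) = (\<Sum>k\<in>I. (p k)\<^sup>2) + (2 * t * u + t\<^sup>2 * w)" for t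
    unfolding u_def w_def
    by (simp add: sum_distrib_left sum.distrib[symmetric] sum_subtractf[symmetric]
        power2_eq_square algebra_simps)
  have *: "0 \<le> 2 * u + t * w" if "0 < t" "t \<le> 1" for t
  proof -
    have "0 \<le> t * (2 * u + t * w)"
      using assms[OF that] unfolding exp by (simp add: algebra_simps power2_eq_square)
    then show ?thesis using that by (simp add: zero_le_mult_iff)
  qed
  \<comment> \<open>This gives \<open>t * w\<close> at most \<open>- u\<close>, hence 2
    \<open>u\<close> + \<open>t * w\<close> at most \<open>u\<close> < 0. The 1 in the denominator
    covers \<open>w\<close> = 0.\<close>
  define t where "t = min 1 (- u / (w + 1))"
  have t: "0 < t" "t \<le> 1" using u w by (auto simp: t_def divide_neg_pos)
  have "t * w \<le> - u / (w + 1) * w" using w by (intro mult_right_mono) (auto simp: t_def)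
  also have "\<dots> \<le> - u" using u w by (simp add: field_simps)
  finally show False using *[OF t] u by linarith
qed

text \<open>
  Barany's argument: a colourful convex combination \<open>p\<close> of least norm, if non-zero, can avoid
  some colour class, since otherwise its \<open>N + 1\<close> points lie in the hyperplane
  \<open>\<langle>p, \<cdot>\<rangle> = \<parallel>p\<parallel>\<^sup>2\<close> and are affinely dependent. Recolouring that class lowers the norm.
  The hypothesis \<open>C\<close> says dually that \<open>0\<close> lies in the convex hull of each colour class.
\<close>

theorem colourful_Caratheodory:
  fixes a :: "nat \<Rightarrow> 'g \<Rightarrow> 'i \<Rightarrow> real"
  assumes I: "finite I" "card I \<le> N"
    and fin: "\<And>j. j \<le> N \<Longrightarrow> finite (C j)"
    and C: "\<And>j y. j \<le> N \<Longrightarrow> \<exists>g\<in>C j. (\<Sum>k\<in>I. y k * a j g k) \<le> 0"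
  obtains c l where "\<And>j. j \<le> N \<Longrightarrow> c j \<in> C j" "l \<in> standard_simplex N"
    "\<And>k. k \<in> I \<Longrightarrow> (\<Sum>j\<le>N. l j * a j (c j) k) = 0"
proof -
  define P where "P c l k = (\<Sum>j\<le>N. l j * a j (c j) k)" for c l k
  define Q where "Q c l = (\<Sum>k\<in>I. (P c l k)\<^sup>2)" for c l
  let ?F = "Pi\<^sub>E {..N} C" and ?S = "standard_simplex N"
  have "finite ?F" using fin by (intro finite_PiE) auto
  have "?F \<noteq> {}" using C by (auto simp: PiE_eq_empty_iff)
  have "\<exists>l\<in>?S. \<forall>l'\<in>?S. Q c l \<le> Q c l'" for c
  proof (rule continuous_attains_inf[OF compact_standard_simplex nonempty_standard_simplex])
    show "continuous_on ?S (Q c)"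
      unfolding Q_def P_def
      by (intro continuous_intros continuous_on_subset[OF continuous_on_product_coordinates]) auto
  qed
  then obtain L where L: "\<And>c. L c \<in> ?S" "\<And>c l'. l' \<in> ?S \<Longrightarrow> Q c (L c) \<le> Q c l'" by metis
  obtain c where c: "c \<in> ?F" "\<And>c'. c' \<in> ?F \<Longrightarrow> Q c (L c) \<le> Q c' (L c')"
    using ex_is_arg_min_if_finite[OF \<open>finite ?F\<close> \<open>?F \<noteq> {}\<close>, of "\<lambda>c. Q c (L c)"]
    by (auto simp: is_arg_min_linorder)
  define l p q where "l = L c" and "p = P c l" and "q = Q c l"
  have l: "l \<in> ?S" by (simp add: l_def L)
  have min: "q \<le> Q c' l'" if "c' \<in> ?F" "l' \<in> ?S" for c' l'
    using L(2)[OF that(2), of c'] c(2)[OF that(1)] by (simp add: l_def q_def)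
  have q: "q = (\<Sum>k\<in>I. (p k)\<^sup>2)" by (simp add: q_def Q_def p_def)
  \<comment> \<open>Allowing every representation of the same point \<open>p\<close>, and not just
    \<open>c\<close> with \<open>l\<close>, lets this be applied after a recolouring that leaves the
    point fixed.\<close>
  have first_order: "q \<le> (\<Sum>k\<in>I. p k * a j (c' j) k)"
    if c': "c' \<in> ?F" and l': "l' \<in> ?S" and eq: "\<And>k. k \<in> I \<Longrightarrow> P c' l' k = p k" and j: "j \<le> N" for c' l' j
    unfolding q
  proof (rule first_order_minimality)
    fix t :: real assume t: "0 < t" "t \<le> 1"
    define lt where "lt i = (1 - t) * l' i + t * vertex j i" for i
    have "lt \<in> ?S" unfolding lt_def
      using t j l' by (intro convex_standard_simplex vertex_in_standard_simplex) auto
    moreover have "P c' lt k = (1 - t) * p k + t * a j (c' j) k" if "k \<in> I" for k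
    proof -
      have "P c' lt k = (\<Sum>i\<le>N. (1 - t) * (l' i * a i (c' i) k) + t * (vertex j i * a i (c' i) k))"
        unfolding P_def lt_def by (simp add: algebra_simps)
      also have "\<dots> = (1 - t) * P c' l' k + t * a j (c' j) k"
        using sum_mult_vertex[OF j, of "\<lambda>i. a i (c' i) k"]
        by (simp add: sum.distrib sum_distrib_left[symmetric] P_def)
      finally show ?thesis using eq[OF that] by simp
    qed
    ultimately show "(\<Sum>k\<in>I. (p k)\<^sup>2) \<le> (\<Sum>k\<in>I. ((1 - t) * p k + t * a j (c' j) k)\<^sup>2)"
      using min[OF c', of lt] by (simp add: Q_def q)
  qed
  \<comment> \<open>A vertex of weight zero can be recoloured without moving \<open>p\<close>.
    Choosing by \<open>C\<close> a colour with nonpositive inner product contradicts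
    \<open>first_order\<close>.\<close>
  have no_zero: False if "q > 0" and l': "l' \<in> ?S" "\<And>k. k \<in> I \<Longrightarrow> P c l' k = p k"
    and j0: "j0 \<le> N" "l' j0 = 0" for l' j0
  proof -
    obtain g where g: "g \<in> C j0" "(\<Sum>k\<in>I. p k * a j0 g k) \<le> 0" using C[OF j0(1)] by blast
    define c' where "c' = c(j0 := g)"
    have "c' \<in> ?F" using c(1) g(1) j0(1) by (auto simp: c'_def PiE_iff extensional_def)
    moreover have "P c' l' k = p k" if "k \<in> I" for k
    proof -
      have "P c' l' k = P c l' k" unfolding P_def
        by (intro sum.cong) (auto simp: c'_def j0)
      with l' that show ?thesis by simp
    qed
    ultimately have "q \<le> (\<Sum>k\<in>I. p k * a j0 (c' j0) k)"
      using first_order l'(1) j0(1) by blast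
    with g(2) \<open>q > 0\<close> show False by (simp add: c'_def)
  qed
  have "q = 0"
  proof (rule ccontr)
    assume "q \<noteq> 0"
    then have "q > 0" using q sum_nonneg[of I "\<lambda>k. (p k)\<^sup>2"] by simp
    define s where "s j = (\<Sum>k\<in>I. p k * a j (c j) k)" for j
    have sum1: "(\<Sum>j\<le>N. l j) = 1" and l0: "l j \<ge> 0" for j
      using l by (auto simp: standard_simplex_def)
    have lpos: "l j > 0" if "j \<le> N" for j
      using no_zero[OF \<open>q > 0\<close> l _ that] l0[of j] by (fastforce simp: p_def)
    have swap: "(\<Sum>j\<le>N. x j * s j) = (\<Sum>k\<in>I. p k * (\<Sum>j\<le>N. x j * a j (c j) k))" for x
      unfolding s_def sum_distrib_left by (subst sum.swap) (simp add: algebra_simps)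
    \<comment> \<open>The numbers \<open>s j\<close> are all at least \<open>q\<close> and have
      weighted mean \<open>q\<close> with positive weights, so they all equal
      \<open>q\<close>.\<close>
    have "(\<Sum>j\<le>N. l j * (s j - q)) = (\<Sum>j\<le>N. l j * s j) - q * (\<Sum>j\<le>N. l j)"
      by (simp add: right_diff_distrib sum_subtractf sum_distrib_left mult.commute)
    also have "\<dots> = 0"
      unfolding swap sum1 by (simp add: q power2_eq_square p_def P_def)
    finally have "(\<Sum>j\<le>N. l j * (s j - q)) = 0" .
    moreover have "0 \<le> l j * (s j - q)" if "j \<in> {..N}" for j
      using first_order[OF c(1) l, of j] that l0[of j] by (simp add: s_def p_def)
    ultimately have "\<forall>j\<in>{..N}. l j * (s j - q) = 0"
      by (subst (asm) sum_nonneg_eq_0_iff) auto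
    then have s: "s j = q" if "j \<le> N" for j using lpos[OF that] that by force
    obtain u where u: "\<exists>j\<in>{..N}. u j \<noteq> 0" "\<And>k. k \<in> I \<Longrightarrow> (\<Sum>j\<le>N. a j (c j) k * u j) = 0"
      using homogeneous_system_nontrivial_solution[of I "{..N}" "\<lambda>k j. a j (c j) k"] I by auto
    have "q * (\<Sum>j\<le>N. u j) = (\<Sum>j\<le>N. u j * s j)"
      using s by (simp add: sum_distrib_left mult.commute)
    also have "\<dots> = 0" unfolding swap using u(2) by (simp add: mult.commute)
    finally have u0: "(\<Sum>j\<le>N. u j) = 0" using \<open>q > 0\<close> by simp
    define U where "U = {j\<in>{..N}. u j > 0}"
    have "U \<noteq> {}"
    proof
      assume "U = {}"
      then have "\<forall>j\<in>{..N}. u j \<le> 0" by (fastforce simp: U_def)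
      with u0 have "\<forall>j\<in>{..N}. u j = 0"
        using sum_nonneg_eq_0_iff[of "{..N}" "\<lambda>j. - u j"] by (simp add: sum_negf)
      with u(1) show False by blast
    qed
    have "finite U" by (simp add: U_def)
    \<comment> \<open>The smallest ratio over the positive \<open>u j\<close> is the first time at
      which \<open>l - t * u\<close> loses a vertex; until then all weights stay
      nonnegative.\<close>
    obtain j0 where j0: "j0 \<in> U" "\<And>j. j \<in> U \<Longrightarrow> l j0 / u j0 \<le> l j / u j"
      using ex_is_arg_min_if_finite[OF \<open>finite U\<close> \<open>U \<noteq> {}\<close>, of "\<lambda>j. l j / u j"]
      by (auto simp: is_arg_min_linorder)
    define t where "t = l j0 / u j0"
    have "t \<ge> 0" using j0 l0 by (simp add: t_def U_def)
    define l' where "l' j = (if j \<le> N then l j - t * u j else 0)" for j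
    have "0 \<le> l' j" for j
    proof (cases "j \<in> U")
      case True
      then show ?thesis using j0(2)[OF True] by (simp add: l'_def t_def[symmetric] U_def field_simps)
    next
      case False
      then have "j \<le> N \<Longrightarrow> t * u j \<le> 0" using \<open>t \<ge> 0\<close> by (simp add: U_def mult_nonneg_nonpos)
      then show ?thesis using l0[of j] by (auto simp: l'_def)
    qed
    moreover have "(\<Sum>j\<le>N. l' j) = 1"
      using sum1 u0 by (simp add: l'_def sum_subtractf sum_distrib_left[symmetric])
    ultimately have "l' \<in> ?S" by (intro standard_simplexI) (auto simp: l'_def)
    moreover have "P c l' k = p k" if "k \<in> I" for k
    proof -
      have "P c l' k = P c l k - t * (\<Sum>j\<le>N. a j (c j) k * u j)"
        by (simp add: P_def l'_def sum_distrib_left sum_subtractf[symmetric] algebra_simps)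
      with u(2)[OF that] show ?thesis by (simp add: p_def)
    qed
    moreover have "j0 \<le> N" "l' j0 = 0" using j0(1) by (auto simp: l'_def t_def U_def)
    ultimately show False using no_zero \<open>q > 0\<close> by blast
  qed
  then have "\<forall>k\<in>I. (p k)\<^sup>2 = 0" unfolding q using I(1) by (subst (asm) sum_nonneg_eq_0_iff) auto
  then show thesis using that[of c l] c(1) l by (auto simp: p_def P_def)
qed

subsection \<open>Characters\<close>

lemma zeta_nonzero [simp]: "zeta q \<noteq> 0"
  by (simp add: zeta_def)

lemma zeta_powi: "zeta q powi n = exp (2 * of_real pi * \<i> * of_int n / of_nat q)"
  by (simp add: zeta_def exp_power_int algebra_simps)

lemma zeta_powi_mod:
  assumes "q > 0" shows "zeta q powi (h * (x mod int q)) = zeta q powi (h * x)"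
proof -
  have "h * x = h * (x mod int q) + int q * (h * (x div int q))"
    by (metis distrib_left mod_mult_div_eq mult.left_commute)
  moreover have "zeta q powi int q = 1"
    using assms exp_two_pi_i by (simp add: zeta_powi del: power_int_of_nat)
  ultimately show ?thesis
    by (metis mult_1_right power_int_1_left power_int_add power_int_mult zeta_nonzero)
qed

lemma zeta_powi_neq_1:
  assumes "0 < n" "n < int q" shows "zeta q powi n \<noteq> 1"
proof
  assume "zeta q powi n = 1"
  then obtain l :: int where "2 * pi * of_int n / of_nat q = of_int (2 * l) * pi"
    by (auto simp: zeta_powi exp_eq_1)
  then have "real_of_int n = real_of_int (l * int q)"
    using assms by (simp add: field_simps)
  then have "n = l * int q" by linarith
  with assms show False
    by (metis dvd_triv_right zdvd_not_zless)
qed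

lemma chi_commute: "chi k r h g = chi k r g h"
  by (simp add: chi_def mult.commute)

lemma norm_chi: "norm (chi k r h g) = 1"
  by (simp add: chi_def zeta_def prod_norm[symmetric] norm_power_int)

lemma inverse_chi: "inverse (chi k r h g) = cnj (chi k r h g)"
  by (metis divide_conv_cnj inverse_eq_divide mult_1 norm_chi)

context
  fixes k :: nat and r :: "nat \<Rightarrow> nat"
  assumes r_pos: "\<And>j. j \<in> {1..k} \<Longrightarrow> r j > 0"
begin

lemma group_cyclic_sum: "group (cyclic_sum k r)"
  unfolding cyclic_sum_def by (rule product_group) simp

lemma carrier_cyclic_sum: "carrier (cyclic_sum k r) = (\<Pi>\<^sub>E j\<in>{1..k}. {0..<int (r j)})"
  unfolding cyclic_sum_def carrier_product_group
  by (intro PiE_cong) (use r_pos in \<open>auto simp: carrier_integer_mod_group\<close>)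

lemma finite_cyclic_sum: "finite (carrier (cyclic_sum k r))"
  by (simp add: carrier_cyclic_sum finite_PiE)

lemma card_cyclic_sum: "card (carrier (cyclic_sum k r)) = (\<Prod>j=1..k. r j)"
  by (simp add: carrier_cyclic_sum card_PiE)

lemma card_cyclic_sum_pos: "card (carrier (cyclic_sum k r)) > 0"
  using r_pos by (auto simp: card_cyclic_sum intro!: prod_pos)

lemma one_cyclic_sum: "\<one>\<^bsub>cyclic_sum k r\<^esub> = (\<lambda>j\<in>{1..k}. 0)"
  by (simp add: cyclic_sum_def)

lemma chi_mult_right: "chi k r h (g \<otimes>\<^bsub>cyclic_sum k r\<^esub> g') = chi k r h g * chi k r h g'"
proof -
  have "chi k r h (g \<otimes>\<^bsub>cyclic_sum k r\<^esub> g') = (\<Prod>j=1..k. zeta (r j) powi (h j * ((g j + g' j) mod int (r j))))"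
    by (simp add: chi_def cyclic_sum_def)
  also have "\<dots> = (\<Prod>j=1..k. zeta (r j) powi (h j * (g j + g' j)))"
    using r_pos by (intro prod.cong) (auto simp: zeta_powi_mod)
  also have "\<dots> = chi k r h g * chi k r h g'"
    by (simp add: chi_def distrib_left power_int_add prod.distrib)
  finally show ?thesis .
qed

lemma chi_mult_left: "chi k r (h \<otimes>\<^bsub>cyclic_sum k r\<^esub> h') g = chi k r h g * chi k r h' g"
  by (metis chi_commute chi_mult_right)

lemma chi_one_left [simp]: "chi k r \<one>\<^bsub>cyclic_sum k r\<^esub> g = 1"
  by (simp add: chi_def one_cyclic_sum)

lemma chi_inv_left:
  assumes "h \<in> carrier (cyclic_sum k r)" shows "chi k r (inv\<^bsub>cyclic_sum k r\<^esub> h) g = inverse (chi k r h g)"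
  by (metis assms chi_mult_left chi_one_left group.r_inv group_cyclic_sum inverse_unique)

lemma chi_nontrivial:
  assumes "h \<in> carrier (cyclic_sum k r)" "h \<noteq> \<one>\<^bsub>cyclic_sum k r\<^esub>"
  obtains g where "g \<in> carrier (cyclic_sum k r)" "chi k r h g \<noteq> 1"
proof -
  have "\<exists>j\<in>{1..k}. h j \<noteq> 0"
  proof (rule ccontr)
    assume "\<not> ?thesis"
    with assms(1) have "h = (\<lambda>j\<in>{1..k}. 0)"
      by (intro PiE_ext[of _ _ "\<lambda>j. {0..<int (r j)}"]) (use r_pos in \<open>auto simp: carrier_cyclic_sum\<close>)
    with assms(2) show False by (simp add: one_cyclic_sum)
  qed
  then obtain j where j: "j \<in> {1..k}" "h j \<noteq> 0" by blast
  have hj: "0 < h j" "h j < int (r j)"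
    using PiE_mem[OF assms(1)[unfolded carrier_cyclic_sum] j(1)] j(2) by auto
  \<comment> \<open>The unit vector at \<open>j\<close> isolates the factor
    \<open>zeta (r j) powi h j\<close>, and 0 < \<open>h j\<close> < \<open>r j\<close> keeps it
    different from 1.\<close>
  define g :: "nat \<Rightarrow> int" where "g = (\<lambda>i\<in>{1..k}. if i = j then 1 else 0)"
  have "g \<in> carrier (cyclic_sum k r)" using r_pos hj by (auto simp: carrier_cyclic_sum g_def)
  moreover have "chi k r h g = (\<Prod>i=1..k. if i = j then zeta (r i) powi h i else 1)"
    unfolding chi_def g_def by (intro prod.cong) auto
  then have "chi k r h g = zeta (r j) powi h j"
    using j(1) by (simp add: prod.delta)
  ultimately show thesis using that zeta_powi_neq_1[OF hj] by simp
qed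

lemma sum_chi:
  assumes "h \<in> carrier (cyclic_sum k r)"
  shows "(\<Sum>g\<in>carrier (cyclic_sum k r). chi k r h g) =
    (if h = \<one>\<^bsub>cyclic_sum k r\<^esub> then of_nat (card (carrier (cyclic_sum k r))) else 0)"
proof (cases "h = \<one>\<^bsub>cyclic_sum k r\<^esub>")
  case False
  interpret group "cyclic_sum k r" by (rule group_cyclic_sum)
  obtain g0 where g0: "g0 \<in> carrier (cyclic_sum k r)" "chi k r h g0 \<noteq> 1" using chi_nontrivial assms False .
  \<comment> \<open>Translation by \<open>g0\<close> permutes the group but multiplies the sum by
    \<open>chi k r h g0\<close>, which is not 1. So the sum is zero.\<close>
  have "(\<Sum>g\<in>carrier (cyclic_sum k r). chi k r h g) =
      (\<Sum>g\<in>carrier (cyclic_sum k r). chi k r h (g0 \<otimes>\<^bsub>cyclic_sum k r\<^esub> g))"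
    by (rule sum.reindex_bij_witness[of _ "\<lambda>g. g0 \<otimes>\<^bsub>cyclic_sum k r\<^esub> g"
        "\<lambda>g. inv\<^bsub>cyclic_sum k r\<^esub> g0 \<otimes>\<^bsub>cyclic_sum k r\<^esub> g"])
      (use g0 in \<open>auto simp: m_assoc[symmetric]\<close>)
  also have "\<dots> = chi k r h g0 * (\<Sum>g\<in>carrier (cyclic_sum k r). chi k r h g)"
    by (simp add: chi_mult_right sum_distrib_left)
  finally show ?thesis using g0(2) False by simp
qed simp

lemma sum_chi_mult:
  assumes "h \<in> carrier (cyclic_sum k r)" "h' \<in> carrier (cyclic_sum k r)"
  shows "(\<Sum>g\<in>carrier (cyclic_sum k r). chi k r h g * chi k r h' g) =
    (if h = inv\<^bsub>cyclic_sum k r\<^esub> h' then of_nat (card (carrier (cyclic_sum k r))) else 0)"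
proof -
  interpret group "cyclic_sum k r" by (rule group_cyclic_sum)
  show ?thesis
    using assms sum_chi[of "h \<otimes>\<^bsub>cyclic_sum k r\<^esub> h'"]
    by (simp add: chi_mult_left) (metis inv_equality l_inv r_inv inv_closed)
qed

lemma sum_chi_mult_inverse:
  assumes "h \<in> carrier (cyclic_sum k r)" "h' \<in> carrier (cyclic_sum k r)"
  shows "(\<Sum>g\<in>carrier (cyclic_sum k r). chi k r h g * inverse (chi k r h' g)) =
    (if h = h' then of_nat (card (carrier (cyclic_sum k r))) else 0)"
  using sum_chi_mult[of h "inv\<^bsub>cyclic_sum k r\<^esub> h'"] assms
  by (simp add: chi_inv_left group.inv_closed[OF group_cyclic_sum] group.inv_inv[OF group_cyclic_sum])

text \<open>Fourier inversion: multiplying by \<open>chi k r h\<close> and summing over the group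
  isolates the coefficient at \<open>h\<close>.\<close>

lemma chi_combination_eq_0:
  assumes H: "H \<subseteq> carrier (cyclic_sum k r)" and h: "h \<in> H"
    and 0: "\<And>g. g \<in> carrier (cyclic_sum k r) \<Longrightarrow> (\<Sum>h\<in>H. \<beta> h * inverse (chi k r h g)) = 0"
  shows "\<beta> h = 0"
proof -
  have fin: "finite H" using H finite_cyclic_sum finite_subset by blast
  have "0 = (\<Sum>g\<in>carrier (cyclic_sum k r). chi k r h g * (\<Sum>h'\<in>H. \<beta> h' * inverse (chi k r h' g)))"
    using 0 by simp
  also have "\<dots> = (\<Sum>h'\<in>H. \<beta> h' * (\<Sum>g\<in>carrier (cyclic_sum k r). chi k r h g * inverse (chi k r h' g)))"
    unfolding sum_distrib_left by (subst sum.swap) (simp add: mult_ac)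
  also have "\<dots> = (\<Sum>h'\<in>H. if h' = h then \<beta> h' * of_nat (card (carrier (cyclic_sum k r))) else 0)"
    using H h by (intro sum.cong) (auto simp: sum_chi_mult_inverse subset_iff)
  also have "\<dots> = \<beta> h * of_nat (card (carrier (cyclic_sum k r)))" using fin h by simp
  finally show ?thesis using card_cyclic_sum_pos by simp
qed

text \<open>Twice the real part is the combination plus its conjugate, in which the coefficient
  belonging to \<open>h\<close> is \<beta>(h) plus the conjugate of \<beta>(-h). The assumption on
  the inverse ensures that the second term is absent or equals the first, so no cancellation can
  occur.\<close>

lemma Re_chi_combination_eq_0:
  assumes H: "H \<subseteq> carrier (cyclic_sum k r)" and h: "h \<in> H"
    and inv: "inv\<^bsub>cyclic_sum k r\<^esub> h \<in> H \<Longrightarrow> inv\<^bsub>cyclic_sum k r\<^esub> h = h \<and> Im (\<beta> h) = 0"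
    and 0: "\<And>g. g \<in> carrier (cyclic_sum k r) \<Longrightarrow> Re (\<Sum>h\<in>H. \<beta> h * inverse (chi k r h g)) = 0"
  shows "\<beta> h = 0"
proof -
  interpret group "cyclic_sum k r" by (rule group_cyclic_sum)
  let ?n = "of_nat (card (carrier (cyclic_sum k r))) :: complex"
  have fin: "finite H" using H finite_cyclic_sum finite_subset by blast
  have hG: "h \<in> carrier (cyclic_sum k r)" using H h by blast
  let ?B = "\<lambda>g. \<Sum>h'\<in>H. \<beta> h' * inverse (chi k r h' g)"
  have "0 = (\<Sum>g\<in>carrier (cyclic_sum k r). chi k r h g * (?B g + cnj (?B g)))"
    using 0 by (simp add: complex_add_cnj del: cnj_sum)
  also have "\<dots> = (\<Sum>g\<in>carrier (cyclic_sum k r). \<Sum>h'\<in>H. \<beta> h' * (chi k r h g * inverse (chi k r h' g))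
      + cnj (\<beta> h') * (chi k r h g * chi k r h' g))"
    by (simp add: inverse_chi sum_distrib_left sum.distrib[symmetric] distrib_left mult_ac)
  also have "\<dots> = (\<Sum>h'\<in>H. \<beta> h' * (\<Sum>g\<in>carrier (cyclic_sum k r). chi k r h g * inverse (chi k r h' g))
      + cnj (\<beta> h') * (\<Sum>g\<in>carrier (cyclic_sum k r). chi k r h g * chi k r h' g))"
    by (subst sum.swap) (simp add: sum_distrib_left sum.distrib)
  also have "\<dots> = (\<Sum>h'\<in>H. (if h' = h then \<beta> h' * ?n else 0)
      + (if h' = inv\<^bsub>cyclic_sum k r\<^esub> h then cnj (\<beta> h') * ?n else 0))"
    using H hG by (intro sum.cong) (auto simp: sum_chi_mult_inverse sum_chi_mult subset_iff)
  also have "\<dots> = (\<beta> h + (if inv\<^bsub>cyclic_sum k r\<^esub> h \<in> H then cnj (\<beta> (inv\<^bsub>cyclic_sum k r\<^esub> h)) else 0)) * ?n"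
    using fin h by (simp add: sum.distrib distrib_right)
  finally have "\<beta> h + (if inv\<^bsub>cyclic_sum k r\<^esub> h \<in> H then cnj (\<beta> (inv\<^bsub>cyclic_sum k r\<^esub> h)) else 0) = 0"
    using card_cyclic_sum_pos by simp
  then show ?thesis
    using inv by (auto simp: complex_eq_iff split: if_splits)
qed

lemma inv_eq_self_of_ord_2:
  assumes "h \<in> carrier (cyclic_sum k r)" "group.ord (cyclic_sum k r) h = 2" shows "inv\<^bsub>cyclic_sum k r\<^esub> h = h"
proof -
  interpret group "cyclic_sum k r" by (rule group_cyclic_sum)
  have "h [^]\<^bsub>cyclic_sum k r\<^esub> (2::nat) = \<one>\<^bsub>cyclic_sum k r\<^esub>" using pow_ord_eq_1[OF assms(1)] assms(2) by simp
  then show ?thesis using assms(1) by (simp add: numeral_2_eq_2 inv_equality)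
qed

lemma chi_real_of_ord_2:
  assumes "h \<in> carrier (cyclic_sum k r)" "group.ord (cyclic_sum k r) h = 2" shows "Im (chi k r h g) = 0"
  by (metis assms chi_inv_left inv_eq_self_of_ord_2 inverse_chi complex_cnj_cancel_iff
      Reals_cnj_iff complex_is_Real_iff)

end

subsection \<open>Translations and null sets\<close>

text \<open>An uncountable union need not be measurable. For continuous nonnegative
  \<open>F v\<close> on a compact set, having a zero means having infimum zero, and the infimum can
  be read off a countable dense subset.\<close>

lemma sets_exists_zero_compact:
  fixes F :: "'a \<Rightarrow> 'b::{metric_space, second_countable_topology} \<Rightarrow> real"
  assumes K: "compact K"
    and meas: "\<And>l. l \<in> K \<Longrightarrow> (\<lambda>v. F v l) \<in> borel_measurable M"
    and cont: "\<And>v. v \<in> space M \<Longrightarrow> continuous_on K (F v)"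
    and nonneg: "\<And>v l. F v l \<ge> 0"
  shows "{v \<in> space M. \<exists>l\<in>K. F v l = 0} \<in> sets M"
proof -
  obtain D where D: "countable D" "D \<subseteq> K" "K \<subseteq> closure D"
    using separable[of K] by blast
  have "(\<exists>l\<in>K. F v l = 0) \<longleftrightarrow> (\<forall>n::nat. \<exists>l\<in>D. F v l < 1 / Suc n)" if v: "v \<in> space M" for v
  proof
    assume "\<exists>l\<in>K. F v l = 0"
    then obtain l where l: "l \<in> K" "F v l = 0" by blast
    show "\<forall>n::nat. \<exists>l\<in>D. F v l < 1 / Suc n"
    proof
      fix n :: nat
      obtain e where e: "e > 0" "\<And>l'. l' \<in> K \<Longrightarrow> dist l' l < e \<Longrightarrow> dist (F v l') (F v l) < 1 / Suc n"
        using cont[OF v, unfolded continuous_on_iff, rule_format, OF l(1), of "1 / Suc n"] by auto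
      obtain l' where "l' \<in> D" "dist l' l < e"
        using D(3) l(1) e(1) unfolding closure_approachable subset_iff by blast
      moreover from this have "dist (F v l') 0 < 1 / Suc n"
        using e(2)[of l'] D(2) l(2) by auto
      ultimately show "\<exists>l\<in>D. F v l < 1 / Suc n"
        by (intro bexI[of _ l']) (auto simp: dist_real_def)
    qed
  next
    assume *: "\<forall>n::nat. \<exists>l\<in>D. F v l < 1 / Suc n"
    then have "K \<noteq> {}" using D(2) by blast
    then obtain l where l: "l \<in> K" "\<And>l'. l' \<in> K \<Longrightarrow> F v l \<le> F v l'"
      using continuous_attains_inf[OF K _ cont[OF v]] by blast
    have "F v l \<le> 0"
    proof (rule ccontr)
      assume "\<not> F v l \<le> 0"
      then obtain n where n: "1 / Suc n < F v l"
        using reals_Archimedean[of "F v l"] by (auto simp: inverse_eq_divide)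
      obtain l' where "l' \<in> D" "F v l' < 1 / Suc n" using * by blast
      moreover from this have "F v l \<le> F v l'" using l(2) D(2) by blast
      ultimately show False using n by linarith
    qed
    then have "F v l = 0" using nonneg[of v l] by linarith
    with l(1) show "\<exists>l\<in>K. F v l = 0" by blast
  qed
  then have "{v \<in> space M. \<exists>l\<in>K. F v l = 0} =
      {v \<in> space M. \<forall>n::nat. \<exists>l\<in>D. F v l < 1 / Suc n}" by blast
  also have "\<dots> \<in> sets M"
  proof -
    have [measurable]: "(\<lambda>v. F v l) \<in> borel_measurable M" if "l \<in> D" for l
      using meas D(2) that by blast
    have "(\<Union>l\<in>D. {v \<in> space M. F v l < 1 / Suc n}) \<in> sets M" for n
      using D(1) by (intro sets.countable_UN'') measurable
    then have "space M \<inter> (\<Inter>n::nat. \<Union>l\<in>D. {v \<in> space M. F v l < 1 / Suc n}) \<in> sets M"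
      by (intro sets.Int sets.top sets.countable_INT) auto
    also have "space M \<inter> (\<Inter>n::nat. \<Union>l\<in>D. {v \<in> space M. F v l < 1 / Suc n}) =
      {v \<in> space M. \<forall>n::nat. \<exists>l\<in>D. F v l < 1 / Suc n}" by blast
    finally show ?thesis .
  qed
  finally show ?thesis .
qed

text \<open>By Fubini, the measure of \<open>B\<close> integrated over all real t equals the
  integral over x of the length of the set of t with \<open>\<tau> t x\<close> in \<open>B\<close>,
  which is zero. As the real line has infinite length, \<open>B\<close> is null. Invariance is asked
  of each \<open>\<tau> t\<close> separately, so t may drive a nonlinear curve of
  translations.\<close>

lemma null_set_if_finite_translates:
  fixes \<tau> :: "real \<Rightarrow> 'a \<Rightarrow> 'a"
  assumes "sigma_finite_measure M"
    and \<tau>[measurable]: "case_prod \<tau> \<in> measurable (lborel \<Otimes>\<^sub>M M) M"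
    and inv: "\<And>t. distr M M (\<tau> t) = M"
    and B[measurable]: "B \<in> sets M"
    and fin: "\<And>x. x \<in> space M \<Longrightarrow> finite {t. \<tau> t x \<in> B}"
  shows "B \<in> null_sets M"
proof -
  interpret M: sigma_finite_measure M by fact
  interpret P: pair_sigma_finite lborel M ..
  have [measurable]: "\<tau> t \<in> measurable M M" for t
    using measurable_Pair2[OF \<tau>, of t] by simp
  have shift: "emeasure M B = (\<integral>\<^sup>+x. indicator B (\<tau> t x) \<partial>M)" for t
    by (subst inv[of t, symmetric])
      (simp add: emeasure_distr nn_integral_indicator[symmetric] nn_integral_distr del: nn_integral_indicator)
  have "(\<integral>\<^sup>+t. emeasure M B \<partial>(lborel :: real measure)) = (\<integral>\<^sup>+t. \<integral>\<^sup>+x. indicator B (\<tau> t x) \<partial>M \<partial>lborel)"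
    by (intro nn_integral_cong) (rule shift)
  also have "\<dots> = (\<integral>\<^sup>+x. \<integral>\<^sup>+t. indicator B (\<tau> t x) \<partial>lborel \<partial>M)"
    by (rule P.Fubini'[symmetric]) measurable
  also have "\<dots> = (\<integral>\<^sup>+x. 0 \<partial>M)"
  proof (rule nn_integral_cong)
    fix x assume x: "x \<in> space M"
    have "(\<integral>\<^sup>+t. indicator B (\<tau> t x) \<partial>lborel) = (\<integral>\<^sup>+t. indicator {t. \<tau> t x \<in> B} t \<partial>lborel)"
      by (simp add: indicator_def)
    also have "\<dots> = emeasure lborel {t. \<tau> t x \<in> B}"
      using fin[OF x] by (intro nn_integral_indicator) (simp add: borel_closed finite_imp_closed)
    also have "\<dots> = 0" using fin[OF x] by (rule emeasure_lborel_countable[OF countable_finite])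
    finally show "(\<integral>\<^sup>+t. indicator B (\<tau> t x) \<partial>lborel) = 0" .
  qed
  finally have "emeasure M B = 0" by (auto simp: ennreal_mult_eq_top_iff)
  with B show ?thesis by blast
qed

text \<open>The preimage of a box is a box, and boxes determine the product measure. This serves
  twice: for the coordinates of one image and for the family of all vertex images.\<close>

lemma distr_PiM_componentwise:
  assumes "finite I" and "\<And>i. sigma_finite_measure (M i)"
    and \<tau>: "\<And>i. i \<in> I \<Longrightarrow> \<tau> i \<in> measurable (M i) (M i)"
    and inv: "\<And>i. i \<in> I \<Longrightarrow> distr (M i) (M i) (\<tau> i) = M i"
  shows "distr (PiM I M) (PiM I M) (\<lambda>x. \<lambda>i\<in>I. \<tau> i (x i)) = PiM I M"
proof -
  interpret product_sigma_finite M by (simp add: product_sigma_finite_def assms(2))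
  have meas: "(\<lambda>x. \<lambda>i\<in>I. \<tau> i (x i)) \<in> measurable (PiM I M) (PiM I M)"
    using \<tau> by (intro measurable_restrict measurable_compose[OF measurable_component_singleton]) auto
  show ?thesis
  proof (rule PiM_eqI[OF \<open>finite I\<close>])
    fix A assume A: "\<And>i. i \<in> I \<Longrightarrow> A i \<in> sets (M i)"
    have "(\<lambda>x. \<lambda>i\<in>I. \<tau> i (x i)) -` (Pi\<^sub>E I A) \<inter> space (PiM I M) =
        (\<Pi>\<^sub>E i\<in>I. \<tau> i -` A i \<inter> space (M i))"
      by (auto simp: space_PiM PiE_iff)
    then have "emeasure (distr (PiM I M) (PiM I M) (\<lambda>x. \<lambda>i\<in>I. \<tau> i (x i))) (Pi\<^sub>E I A) =
        emeasure (PiM I M) (\<Pi>\<^sub>E i\<in>I. \<tau> i -` A i \<inter> space (M i))"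
      using A \<open>finite I\<close> by (subst emeasure_distr[OF meas]) (auto intro!: sets_PiM_I_finite)
    also have "\<dots> = (\<Prod>i\<in>I. emeasure (M i) (\<tau> i -` A i \<inter> space (M i)))"
      using A \<open>finite I\<close> \<tau> by (intro emeasure_PiM) (auto intro: measurable_sets)
    also have "\<dots> = (\<Prod>i\<in>I. emeasure (M i) (A i))"
    proof (rule prod.cong)
      fix i assume i: "i \<in> I"
      have "emeasure (M i) (\<tau> i -` A i \<inter> space (M i)) = emeasure (distr (M i) (M i) (\<tau> i)) (A i)"
        using A i \<tau> by (simp add: emeasure_distr)
      with inv[OF i] show "emeasure (M i) (\<tau> i -` A i \<inter> space (M i)) = emeasure (M i) (A i)" by simp
    qed simp
    finally show "emeasure (distr (PiM I M) (PiM I M) (\<lambda>x. \<lambda>i\<in>I. \<tau> i (x i))) (Pi\<^sub>E I A) =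
        (\<Prod>i\<in>I. emeasure (M i) (A i))" .
  qed simp
qed

section \<open>Translation invariance of the measure on vertex images\<close>

lemma sigma_finite_PiM:
  assumes "finite I" "\<And>i. sigma_finite_measure (M i)"
  shows "sigma_finite_measure (PiM I M)"
proof -
  interpret product_sigma_finite M by (simp add: product_sigma_finite_def assms(2))
  show ?thesis by (rule sigma_finite[OF assms(1)])
qed

lemma sigma_finite_target_measure: "sigma_finite_measure (target_measure d d')"
proof -
  interpret A: sigma_finite_measure "\<Pi>\<^sub>M i\<in>{1..d}. (lborel :: complex measure)"
    by (intro sigma_finite_PiM) (auto intro: sigma_finite_lborel)
  interpret B: sigma_finite_measure "\<Pi>\<^sub>M i\<in>{d+1..d+d'}. (lborel :: real measure)"
    by (intro sigma_finite_PiM) (auto intro: sigma_finite_lborel)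
  interpret pair_sigma_finite "\<Pi>\<^sub>M i\<in>{1..d}. (lborel :: complex measure)"
    "\<Pi>\<^sub>M i\<in>{d+1..d+d'}. (lborel :: real measure)" ..
  show ?thesis unfolding target_measure_def by unfold_locales
qed

lemma sigma_finite_vertex_images_measure: "sigma_finite_measure (vertex_images_measure N d d')"
  unfolding vertex_images_measure_def by (intro sigma_finite_PiM sigma_finite_target_measure) simp

text \<open>One complex family \<open>w\<close> moves both kinds of coordinates, the real ones by
  its real part. The restrictions keep the result extensional, hence in the space of the product
  measure.\<close>

definition target_shift :: "nat \<Rightarrow> nat \<Rightarrow> (nat \<Rightarrow> complex) \<Rightarrow> cvec_rvec \<Rightarrow> cvec_rvec" where
  "target_shift d d' w y =
     (\<lambda>i\<in>{1..d}. w i + fst y i, \<lambda>i\<in>{d+1..d+d'}. Re (w i) + snd y i)"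

definition vertex_shift ::
    "nat \<Rightarrow> nat \<Rightarrow> nat \<Rightarrow> (nat \<Rightarrow> nat \<Rightarrow> complex) \<Rightarrow> (nat \<Rightarrow> cvec_rvec) \<Rightarrow> nat \<Rightarrow> cvec_rvec" where
  "vertex_shift N d d' w v = (\<lambda>j\<in>{..N}. target_shift d d' (w j) (v j))"

lemma coord_vertex_shift:
  assumes "j \<le> N" "i \<in> {1..d+d'}"
  shows "coord d i (vertex_shift N d d' w v j) =
    coord d i (v j) + (if i \<le> d then w j i else of_real (Re (w j i)))"
  using assms by (auto simp: coord_def vertex_shift_def target_shift_def)

lemma measurable_target_shift:
  assumes "\<And>i. (\<lambda>x. w x i) \<in> borel_measurable M"
    and "y \<in> measurable M (target_measure d d')"
  shows "(\<lambda>x. target_shift d d' (w x) (y x)) \<in> measurable M (target_measure d d')"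
proof -
  have "(\<lambda>x. fst (y x) i) \<in> measurable M lborel" if "i \<in> {1..d}" for i
    using measurable_compose[OF measurable_compose[OF assms(2)[unfolded target_measure_def]
        measurable_fst] measurable_component_singleton[OF that]] .
  moreover have "(\<lambda>x. snd (y x) i) \<in> measurable M lborel" if "i \<in> {d+1..d+d'}" for i
    using measurable_compose[OF measurable_compose[OF assms(2)[unfolded target_measure_def]
        measurable_snd] measurable_component_singleton[OF that]] .
  ultimately show ?thesis
    unfolding target_measure_def target_shift_def measurable_lborel2
    by (intro measurable_Pair measurable_restrict)
      (auto intro!: borel_measurable_add assms(1) measurable_compose[OF assms(1) borel_measurable_Re])
qed

lemma measurable_vertex_shift:
  assumes [measurable]: "\<And>j i. (\<lambda>t. w t j i) \<in> borel_measurable borel"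
  shows "(\<lambda>(t, v). vertex_shift N d d' (w t) v) \<in>
    measurable (lborel \<Otimes>\<^sub>M vertex_images_measure N d d') (vertex_images_measure N d d')"
proof -
  have "(\<lambda>x. snd x j) \<in> measurable (lborel \<Otimes>\<^sub>M vertex_images_measure N d d') (target_measure d d')"
    if "j \<in> {..N}" for j
    unfolding vertex_images_measure_def
    by (rule measurable_compose[OF measurable_snd measurable_component_singleton[OF that]])
  then show ?thesis
    unfolding vertex_images_measure_def vertex_shift_def case_prod_beta
    by (intro measurable_restrict measurable_target_shift) (auto simp: vertex_images_measure_def)
qed

lemma distr_target_shift:
  "distr (target_measure d d') (target_measure d d') (target_shift d d' w) = target_measure d d'"
proof -
  let ?A = "\<Pi>\<^sub>M i\<in>{1..d}. (lborel :: complex measure)"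
  let ?B = "\<Pi>\<^sub>M i\<in>{d+1..d+d'}. (lborel :: real measure)"
  let ?f = "\<lambda>x. \<lambda>i\<in>{1..d}. w i + x i" and ?g = "\<lambda>x. \<lambda>i\<in>{d+1..d+d'}. Re (w i) + x i"
  have lborel_shift: "distr lborel lborel ((+) c) = lborel" for c :: "'a::euclidean_space"
    using lborel_distr_plus[of c] by (simp cong: distr_cong)
  have f: "distr ?A ?A ?f = ?A"
    by (rule distr_PiM_componentwise)
      (auto intro: sigma_finite_lborel lborel_distr_plus simp: lborel_shift)
  have g: "distr ?B ?B ?g = ?B"
    by (rule distr_PiM_componentwise)
      (auto intro: sigma_finite_lborel lborel_distr_plus simp: lborel_shift)
  have mf: "?f \<in> measurable ?A ?A" and mg: "?g \<in> measurable ?B ?B"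
    by (auto intro!: measurable_restrict)
  have "sigma_finite_measure (distr ?B ?B ?g)"
    unfolding g by (intro sigma_finite_PiM) (auto intro: sigma_finite_lborel)
  from pair_measure_distr[OF mf mg this]
  have "?A \<Otimes>\<^sub>M ?B = distr (?A \<Otimes>\<^sub>M ?B) (?A \<Otimes>\<^sub>M ?B) (\<lambda>(x, y). (?f x, ?g y))"
    unfolding f g .
  then show ?thesis
    unfolding target_measure_def target_shift_def case_prod_beta by simp
qed

lemma distr_vertex_shift:
  "distr (vertex_images_measure N d d') (vertex_images_measure N d d') (vertex_shift N d d' w) =
    vertex_images_measure N d d'"
  unfolding vertex_images_measure_def vertex_shift_def
proof (rule distr_PiM_componentwise)
  show "target_shift d d' (w j) \<in> measurable (target_measure d d') (target_measure d d')" for j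
    using measurable_target_shift[of "\<lambda>_. w j" "target_measure d d'" "\<lambda>y. y"] by simp
qed (auto intro: sigma_finite_target_measure distr_target_shift)

lemma borel_measurable_coord_vertex_images:
  assumes "j \<le> N" "i \<in> {1..d+d'}"
  shows "(\<lambda>v. coord d i (v j)) \<in> borel_measurable (vertex_images_measure N d d')"
proof -
  let ?M = "vertex_images_measure N d d'"
  have vj: "(\<lambda>v. v j) \<in> measurable ?M (target_measure d d')"
    unfolding vertex_images_measure_def using assms(1) by (intro measurable_component_singleton) simp
  show ?thesis
  proof (cases "i \<le> d")
    case True
    with assms(2) have "i \<in> {1..d}" by simp
    then have "(\<lambda>v. fst (v j) i) \<in> measurable ?M lborel"
      using vj unfolding target_measure_def
      by (intro measurable_compose[OF measurable_compose[OF _ measurable_fst] measurable_component_singleton])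
    with True show ?thesis by (simp add: coord_def)
  next
    case False
    with assms(2) have "i \<in> {d+1..d+d'}" by simp
    then have "(\<lambda>v. snd (v j) i) \<in> measurable ?M lborel"
      using vj unfolding target_measure_def
      by (intro measurable_compose[OF measurable_compose[OF _ measurable_snd] measurable_component_singleton])
    then have "(\<lambda>v. snd (v j) i) \<in> borel_measurable ?M" by simp
    with False show ?thesis by (simp add: coord_def)
  qed
qed

subsection \<open>Fourier coefficients of coloured convex combinations\<close>

lemma standard_simplex_eq_vertex:
  assumes "x \<in> standard_simplex N" "x j0 = 1"
  shows "x = vertex j0"
proof -
  have x: "\<And>j. 0 \<le> x j" "\<And>j. j > N \<Longrightarrow> x j = 0" "(\<Sum>j\<le>N. x j) = 1"
    using assms(1) by (auto simp: standard_simplex_def)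
  then have "j0 \<le> N" using assms(2) by (metis linorder_not_le zero_neq_one)
  then have "(\<Sum>j\<in>{..N} - {j0}. x j) = 0" using x(3) assms(2) by (simp add: sum.remove)
  then have "\<forall>j\<in>{..N} - {j0}. x j = 0" using x(1) by (subst (asm) sum_nonneg_eq_0_iff) auto
  then have "x j = 0" if "j \<noteq> j0" for j using x(2)[of j] that by (cases "j \<le> N") auto
  then show ?thesis using assms(2) by (auto simp: vertex_def fun_eq_iff)
qed

text \<open>Affinity is given for two points only. Induction on a bound \<open>n\<close> for the
  support splits off one vertex at a time and renormalises the rest.\<close>

lemma affine_map_coord:
  assumes f: "affine_map N d d' f" and i: "i \<in> {1..d+d'}" and x: "x \<in> standard_simplex N"
  shows "coord d i (f x) = (\<Sum>j\<le>N. of_real (x j) * coord d i (f (vertex j)))"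
proof -
  let ?F = "\<lambda>x. coord d i (f x)"
  let ?L = "\<lambda>x. \<Sum>j\<le>N. of_real (x j) * ?F (vertex j)"
  have aff: "?F (\<lambda>j. (1 - t) * x j + t * y j) = of_real (1 - t) * ?F x + of_real t * ?F y"
    if "x \<in> standard_simplex N" "y \<in> standard_simplex N" "t \<in> {0..1}" for x y t
    using f i that unfolding affine_map_def by blast
  have L_vertex: "?L (vertex j) = ?F (vertex j)" if "j \<le> N" for j
    using that by (simp add: vertex_def if_distrib[of of_real] if_distrib[of "\<lambda>u. u * _"] sum.delta
        cong: if_cong)
  have "x \<in> standard_simplex N \<Longrightarrow> n \<le> N \<Longrightarrow> (\<forall>j>n. x j = 0) \<Longrightarrow> ?F x = ?L x" for n x
  proof (induction n arbitrary: x)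
    case 0
    then have "(\<Sum>j\<le>N. x j) = x 0"
      by (subst sum.mono_neutral_right[of _ "{0}"]) auto
    with 0 have "x 0 = 1" by (simp add: standard_simplex_def)
    with 0 standard_simplex_eq_vertex L_vertex[of 0] show ?case by simp
  next
    case (Suc n)
    define t where "t = x (Suc n)"
    have xs: "\<And>j. 0 \<le> x j" "\<And>j. x j \<le> 1" "(\<Sum>j\<le>N. x j) = 1"
      using Suc.prems(1) by (auto simp: standard_simplex_def)
    show ?case
    \<comment> \<open>Renormalising divides by 1 - \<open>t\<close>; for \<open>t\<close> = 1 the
      point is itself a vertex.\<close>
    proof (cases "t = 1")
      case True
      with Suc.prems standard_simplex_eq_vertex L_vertex[of "Suc n"] show ?thesis by (simp add: t_def)
    next
      case False
      then have t: "0 \<le> t" "t < 1" using xs(1,2)[of "Suc n"] by (auto simp: t_def)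
      define y where "y j = (if j = Suc n then 0 else x j / (1 - t))" for j
      have x_eq: "x = (\<lambda>j. (1 - t) * y j + t * vertex (Suc n) j)"
        using t by (auto simp: y_def vertex_def t_def fun_eq_iff)
      have "(\<Sum>j\<le>N. y j) = (\<Sum>j\<in>{..N} - {Suc n}. x j / (1 - t))"
        using Suc.prems(2) by (subst sum.remove[of _ "Suc n"]) (auto simp: y_def intro!: sum.cong)
      also have "\<dots> = (\<Sum>j\<in>{..N} - {Suc n}. x j) / (1 - t)" by (simp add: sum_divide_distrib)
      also have "(\<Sum>j\<in>{..N} - {Suc n}. x j) = 1 - t"
        using xs(3) Suc.prems(2) by (simp add: sum.remove[of _ "Suc n"] t_def)
      finally have "(\<Sum>j\<le>N. y j) = 1" using t by simp
      then have y: "y \<in> standard_simplex N"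
        using xs(1) t Suc.prems by (intro standard_simplexI) (auto simp: y_def)
      have "\<forall>j>n. y j = 0" using Suc.prems(3) by (auto simp: y_def)
      with Suc.IH[of y] y Suc.prems(2) have IH: "?F y = ?L y" by simp
      have "?F x = of_real (1 - t) * ?F y + of_real t * ?F (vertex (Suc n))"
        by (subst x_eq) (rule aff[OF y vertex_in_standard_simplex], use t Suc.prems(2) in auto)
      also have "\<dots> = of_real (1 - t) * ?L y + of_real t * ?L (vertex (Suc n))"
        unfolding IH L_vertex[OF Suc.prems(2)] ..
      also have "\<dots> = ?L x"
        by (simp add: fun_cong[OF x_eq] sum_distrib_left sum.distrib[symmetric] algebra_simps)
      finally show ?thesis .
    qed
  qed
  from this[where x=x and n=N] x show ?thesis by (auto simp: standard_simplex_def)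
qed

text \<open>A face containing \<open>x g\<close> contains every vertex of its support, so disjoint
  faces force disjoint supports. Conversely the smallest faces carrying the points are disjoint,
  since a common point would have all coordinates zero.\<close>

lemma disjoint_faces_iff:
  assumes x: "\<And>g. g \<in> I \<Longrightarrow> x g \<in> standard_simplex N"
  shows "pairwise_disjoint_support N I x \<longleftrightarrow>
    (\<forall>g\<in>I. \<forall>g'\<in>I. \<forall>j. x g j \<noteq> 0 \<longrightarrow> x g' j \<noteq> 0 \<longrightarrow> g = g')"
proof
  assume "pairwise_disjoint_support N I x"
  then obtain \<sigma> where \<sigma>: "\<And>g. g \<in> I \<Longrightarrow> face_of_simplex N (\<sigma> g)" "\<And>g. g \<in> I \<Longrightarrow> x g \<in> \<sigma> g"
    "disjoint_family_on \<sigma> I" by (auto simp: pairwise_disjoint_support_def)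
  have vertex: "vertex j \<in> \<sigma> g" if g: "g \<in> I" and "x g j \<noteq> 0" for g j
  proof -
    obtain A where A: "A \<subseteq> {..N}" "\<sigma> g = {x \<in> standard_simplex N. \<forall>i. i \<notin> A \<longrightarrow> x i = 0}"
      using \<sigma>(1)[OF g] by (auto simp: face_of_simplex_def)
    with \<sigma>(2)[OF g] that have "j \<in> A" by blast
    with A(1) have "vertex j \<in> standard_simplex N" by (intro vertex_in_standard_simplex) auto
    with A(2) \<open>j \<in> A\<close> show ?thesis by (auto simp: vertex_def)
  qed
  show "\<forall>g\<in>I. \<forall>g'\<in>I. \<forall>j. x g j \<noteq> 0 \<longrightarrow> x g' j \<noteq> 0 \<longrightarrow> g = g'"
    using vertex disjoint_family_onD[OF \<sigma>(3)] by blast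
next
  assume *: "\<forall>g\<in>I. \<forall>g'\<in>I. \<forall>j. x g j \<noteq> 0 \<longrightarrow> x g' j \<noteq> 0 \<longrightarrow> g = g'"
  define \<sigma> where "\<sigma> g = {y \<in> standard_simplex N. \<forall>i. i \<notin> {j. x g j \<noteq> 0} \<longrightarrow> y i = 0}" for g
  have "face_of_simplex N (\<sigma> g)" if "g \<in> I" for g
    unfolding face_of_simplex_def \<sigma>_def
    by (rule exI[of _ "{j. x g j \<noteq> 0}"])
      (use x[OF that] in \<open>auto simp: standard_simplex_def not_le[symmetric]\<close>)
  moreover have "x g \<in> \<sigma> g" if "g \<in> I" for g using x[OF that] by (simp add: \<sigma>_def)
  moreover have "disjoint_family_on \<sigma> I"
  proof (unfold disjoint_family_on_def, intro ballI impI equals0I)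
    fix g g' y assume g: "g \<in> I" "g' \<in> I" "g \<noteq> g'" and y: "y \<in> \<sigma> g \<inter> \<sigma> g'"
    have "y j = 0" for j
    proof -
      have "x g j = 0 \<or> x g' j = 0" using * g by blast
      then show ?thesis using y by (auto simp: \<sigma>_def)
    qed
    moreover have "(\<Sum>j\<le>N. y j) = 1" using y by (simp add: \<sigma>_def standard_simplex_def)
    ultimately show False by simp
  qed
  ultimately show "pairwise_disjoint_support N I x" unfolding pairwise_disjoint_support_def by blast
qed

definition part :: "bool \<Rightarrow> complex \<Rightarrow> real" where
  "part b z = (if b then Im z else Re z)"

lemma part_simps:
  "part b (x + y) = part b x + part b y" "part b 0 = 0"
  "part b (of_real s * x) = s * part b x" "part b (sum f A) = (\<Sum>a\<in>A. part b (f a))"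
  by (simp_all add: part_def)

section \<open>The real linear system attached to a colouring\<close>

locale fourier_constraints =
  fixes d d' k :: nat and r :: "nat \<Rightarrow> nat" and S T :: "nat \<Rightarrow> (nat \<Rightarrow> int) set"
  assumes r: "\<And>j. j \<in> {1..k} \<Longrightarrow> r j > 0"
    and S: "\<And>i. i \<in> {1..d+d'} \<Longrightarrow> S i \<subseteq> carrier (cyclic_sum k r) - {\<one>\<^bsub>cyclic_sum k r\<^esub>}"
    and T: "\<And>i. i \<in> {d+1..d+d'} \<Longrightarrow> T i = {h \<in> S i. group.ord (cyclic_sum k r) h = 2}"
    and S_T: "\<And>i h. i \<in> {d+1..d+d'} \<Longrightarrow> h \<in> S i - T i \<Longrightarrow> inv\<^bsub>cyclic_sum k r\<^esub> h \<notin> S i"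
begin

abbreviation "G \<equiv> carrier (cyclic_sum k r)"
abbreviation "order_G \<equiv> card G"

lemmas finite_G = finite_cyclic_sum[where k=k and r=r, OF r]
  and order_pos = card_cyclic_sum_pos[where k=k and r=r, OF r]

lemma finite_S: "i \<in> {1..d+d'} \<Longrightarrow> finite (S i)"
  using S finite_G by (meson Diff_subset finite_subset order_trans)

lemma S_G: "i \<in> {1..d+d'} \<Longrightarrow> h \<in> S i \<Longrightarrow> h \<in> G"
  using S by blast

definition vanishing_family :: "nat \<Rightarrow> ((nat \<Rightarrow> real) \<Rightarrow> cvec_rvec) \<Rightarrow> bool" where
  "vanishing_family N f \<longleftrightarrow>
    (\<exists>x. (\<forall>g\<in>G. x g \<in> standard_simplex N) \<and> pairwise_disjoint_support N G x \<and>
      (\<forall>i\<in>{1..d+d'}. \<forall>h\<in>S i. fourier_coeff d k r f x i h = 0))"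

text \<open>For real targets and \<open>h\<close> of order 2 the coefficient is automatically real, so its imaginary
  part gives no equation.\<close>

definition real_eqs :: "(nat \<times> (nat \<Rightarrow> int) \<times> bool) set" where
  "real_eqs = (SIGMA i:{1..d+d'}. SIGMA h:S i. if d < i \<and> h \<in> T i then {False} else UNIV)"

definition eq_coeff :: "(nat \<Rightarrow> complex) \<Rightarrow> (nat \<Rightarrow> int) \<Rightarrow> nat \<times> (nat \<Rightarrow> int) \<times> bool \<Rightarrow> real" where
  "eq_coeff u g = (\<lambda>(i, h, b). part b (u i * inverse (chi k r h g)))"

text \<open>Arbitrary images \<open>u\<close> stand in place of a map, so that translated images can
  be inserted.\<close>

definition coloured_solution ::
    "nat \<Rightarrow> (nat \<Rightarrow> nat \<Rightarrow> complex) \<Rightarrow> (nat \<Rightarrow> nat \<Rightarrow> int) \<Rightarrow> (nat \<Rightarrow> real) \<Rightarrow> bool" where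
  "coloured_solution N u c l \<longleftrightarrow>
    (\<forall>g\<in>G. (\<Sum>j\<le>N. l j * of_bool (c j = g)) = 1 / order_G) \<and>
    (\<forall>e\<in>real_eqs. (\<Sum>j\<le>N. l j * eq_coeff (u j) (c j) e) = 0)"

lemma finite_real_eqs: "finite real_eqs"
  unfolding real_eqs_def by (intro finite_SigmaI finite_S) auto

lemma card_real_eqs:
  "int (card real_eqs) = 2 * int (\<Sum>i=1..d+d'. card (S i)) - int (\<Sum>i=d+1..d+d'. card (T i))"
proof -
  let ?f = "\<lambda>i. if d < i then card (T i) else 0"
  have inner: "int (card (SIGMA h:S i. if d < i \<and> h \<in> T i then {False} else UNIV)) =
      2 * int (card (S i)) - int (?f i)" if i: "i \<in> {1..d+d'}" for i
  proof -
    have "int (card (SIGMA h:S i. if d < i \<and> h \<in> T i then {False} else UNIV)) =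
        (\<Sum>h\<in>S i. 2 - of_bool (d < i \<and> h \<in> T i))"
      using finite_S[OF i] by (subst card_SigmaI) (auto intro!: sum.cong)
    also have "\<dots> = 2 * int (card (S i)) - int (card (S i \<inter> {h. d < i \<and> h \<in> T i}))"
      using finite_S[OF i] by (simp add: sum_subtractf sum_of_bool_eq)
    also have "S i \<inter> {h. d < i \<and> h \<in> T i} = (if d < i then T i else {})"
      using T[of i] i by auto
    finally show ?thesis by simp
  qed
  have "int (card real_eqs) =
      (\<Sum>i=1..d+d'. int (card (SIGMA h:S i. if d < i \<and> h \<in> T i then {False} else UNIV)))"
    unfolding real_eqs_def using finite_S by (subst card_SigmaI) auto
  also have "\<dots> = (\<Sum>i=1..d+d'. 2 * int (card (S i)) - int (?f i))"
    using inner by (intro sum.cong) auto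
  also have "\<dots> = 2 * int (\<Sum>i=1..d+d'. card (S i)) - int (\<Sum>i=1..d+d'. ?f i)"
    by (simp only: sum_subtractf of_nat_sum sum_distrib_left)
  also have "(\<Sum>i=1..d+d'. ?f i) = (\<Sum>i=d+1..d+d'. card (T i))"
    by (intro sum.mono_neutral_cong_right) auto
  finally show ?thesis .
qed

text \<open>The imaginary equations left out of \<open>real_eqs\<close> hold automatically: there
  both the image coordinate and the character are real.\<close>

lemma complex_eq_if_real_eqs:
  assumes real: "\<And>j i. j \<le> N \<Longrightarrow> i > d \<Longrightarrow> Im (u j i) = 0"
    and sol: "coloured_solution N u c l" and i: "i \<in> {1..d+d'}" "h \<in> S i"
  shows "(\<Sum>j\<le>N. of_real (l j) * (u j i * inverse (chi k r h (c j)))) = 0"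
proof -
  have part: "part b (\<Sum>j\<le>N. of_real (l j) * (u j i * inverse (chi k r h (c j)))) = 0" for b
  proof (cases "(i, h, b) \<in> real_eqs")
    case True
    with sol show ?thesis by (auto simp: coloured_solution_def part_simps eq_coeff_def)
  next
    case False
    with i have b: "b" "d < i" "h \<in> T i" by (auto simp: real_eqs_def split: if_splits)
    with T[of i] i have "group.ord (cyclic_sum k r) h = 2" by simp
    then have "Im (chi k r h g) = 0" for g
      using chi_real_of_ord_2[where k=k and r=r, OF r S_G[OF i]] by blast
    with real b show ?thesis by (simp add: part_def inverse_chi)
  qed
  from part[of False] part[of True] show ?thesis by (simp add: part_def complex_eq_iff)
qed

text \<open>Each vertex contributes only to the point of its own colour, and the rescaling by
  \<open>order_G\<close> cancels the normalisation of the Fourier coefficient.\<close>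

lemma fourier_coeff_coloured:
  fixes l :: "nat \<Rightarrow> real"
  assumes f: "affine_map N d d' f" and c: "\<And>j. j \<le> N \<Longrightarrow> c j \<in> G"
    and x: "\<And>g. g \<in> G \<Longrightarrow> x g \<in> standard_simplex N"
    and x_eq: "\<And>g j. g \<in> G \<Longrightarrow> j \<le> N \<Longrightarrow> x g j = real order_G * (l j * of_bool (c j = g))"
    and i: "i \<in> {1..d+d'}"
  shows "fourier_coeff d k r f x i h =
    (\<Sum>j\<le>N. of_real (l j) * (coord d i (f (vertex j)) * inverse (chi k r h (c j))))"
proof -
  let ?n = "of_nat order_G :: complex" and ?v = "\<lambda>j. coord d i (f (vertex j))"
  have "(\<Sum>g\<in>G. coord d i (f (x g)) * inverse (chi k r h g)) =
      (\<Sum>g\<in>G. \<Sum>j\<le>N. of_real (x g j) * ?v j * inverse (chi k r h g))"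
    by (intro sum.cong refl) (simp add: affine_map_coord[OF f i x] sum_distrib_right)
  also have "\<dots> = (\<Sum>j\<le>N. \<Sum>g\<in>G. if c j = g then ?n * (of_real (l j) * (?v j * inverse (chi k r h g))) else 0)"
    by (subst sum.swap) (intro sum.cong refl, auto simp: x_eq)
  also have "\<dots> = (\<Sum>j\<le>N. ?n * (of_real (l j) * (?v j * inverse (chi k r h (c j)))))"
    using c finite_G by (intro sum.cong refl) (simp add: sum.delta')
  finally show ?thesis
    using order_pos by (simp add: fourier_coeff_def sum_distrib_left[symmetric])
qed

lemma vanishing_family_if_coloured_solution:
  assumes f: "affine_map N d d' f" and c: "\<And>j. j \<le> N \<Longrightarrow> c j \<in> G"
    and l: "l \<in> standard_simplex N"
    and sol: "coloured_solution N (\<lambda>j i. coord d i (f (vertex j))) c l"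
  shows "vanishing_family N f"
proof -
  define x where "x g j = (if j \<le> N then order_G * (l j * of_bool (c j = g)) else 0)" for g j
  have x: "x g \<in> standard_simplex N" if "g \<in> G" for g
  proof (rule standard_simplexI)
    show "0 \<le> x g j" for j using l by (simp add: x_def standard_simplex_def)
    have "(\<Sum>j\<le>N. x g j) = order_G * (\<Sum>j\<le>N. l j * of_bool (c j = g))"
      unfolding sum_distrib_left by (intro sum.cong) (auto simp: x_def)
    then show "(\<Sum>j\<le>N. x g j) = 1"
      using sol that order_pos by (simp add: coloured_solution_def)
  qed (simp add: x_def)
  have "pairwise_disjoint_support N G x"
    by (subst disjoint_faces_iff) (use x in \<open>auto simp: x_def split: if_splits\<close>)
  moreover have "fourier_coeff d k r f x i h = 0" if "i \<in> {1..d+d'}" "h \<in> S i" for i h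
    using complex_eq_if_real_eqs[OF _ sol that] fourier_coeff_coloured[OF f c x, where l=l and i=i and h=h] that
    by (simp add: x_def coord_def)
  ultimately show ?thesis using x unfolding vanishing_family_def by blast
qed

lemma coloured_solution_if_vanishing_family:
  assumes f: "affine_map N d d' f" and "vanishing_family N f"
  obtains c l where "c \<in> {..N} \<rightarrow>\<^sub>E G" "l \<in> standard_simplex N"
    "coloured_solution N (\<lambda>j i. coord d i (f (vertex j))) c l"
proof -
  let ?u = "\<lambda>j i. coord d i (f (vertex j))"
  obtain x where x: "\<And>g. g \<in> G \<Longrightarrow> x g \<in> standard_simplex N"
    and disj: "pairwise_disjoint_support N G x"
    and 0: "\<And>i h. i \<in> {1..d+d'} \<Longrightarrow> h \<in> S i \<Longrightarrow> fourier_coeff d k r f x i h = 0"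
    using assms(2) unfolding vanishing_family_def by blast
  have uniq: "\<And>g g' j. g \<in> G \<Longrightarrow> g' \<in> G \<Longrightarrow> x g j \<noteq> 0 \<Longrightarrow> x g' j \<noteq> 0 \<Longrightarrow> g = g'"
    using disj x disjoint_faces_iff[of G x N] by blast
  obtain g0 where "g0 \<in> G" using order_pos by fastforce
  \<comment> \<open>A vertex lying in none of the supports receives the arbitrary colour
    \<open>g0\<close>; its weight is zero.\<close>
  have "\<exists>g. g \<in> G \<and> (\<forall>g'\<in>G. x g' j \<noteq> 0 \<longrightarrow> g' = g)" for j
    using uniq \<open>g0 \<in> G\<close> by (cases "\<exists>g\<in>G. x g j \<noteq> 0") blast+
  then obtain C where C: "\<And>j. C j \<in> G" "\<And>g j. g \<in> G \<Longrightarrow> x g j \<noteq> 0 \<Longrightarrow> g = C j" by metis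
  \<comment> \<open>Extensional colourings form a finite set, as the later union of null sets
    requires.\<close>
  define c where "c = restrict C {..N}"
  define l where "l j = (\<Sum>g\<in>G. x g j) / order_G" for j
  have c: "c \<in> {..N} \<rightarrow>\<^sub>E G" using C(1) by (simp add: c_def)
  have x_eq: "x g j = order_G * (l j * of_bool (c j = g))" if "g \<in> G" "j \<le> N" for g j
  proof (cases "c j = g")
    case True
    have "(\<Sum>g'\<in>G. x g' j) = (\<Sum>g'\<in>{g}. x g' j)"
      using C(2) that True finite_G by (intro sum.mono_neutral_right) (auto simp: c_def)
    with True show ?thesis using order_pos by (simp add: l_def)
  next
    case False
    with C(2)[of g j] that show ?thesis by (auto simp: c_def)
  qed
  have xs: "0 \<le> x g j" "(\<Sum>j\<le>N. x g j) = 1" "j > N \<Longrightarrow> x g j = 0" if "g \<in> G" for g j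
    using x[OF that] by (auto simp: standard_simplex_def)
  have "l \<in> standard_simplex N"
  proof (rule standard_simplexI)
    show "0 \<le> l j" for j using xs by (simp add: l_def sum_nonneg)
    show "l j = 0" if "j > N" for j using xs that by (simp add: l_def)
    have "(\<Sum>j\<le>N. l j) = (\<Sum>g\<in>G. \<Sum>j\<le>N. x g j) / order_G"
      unfolding l_def sum_divide_distrib[symmetric] by (subst sum.swap) simp
    then show "(\<Sum>j\<le>N. l j) = 1" using xs(2) order_pos by simp
  qed
  moreover have "coloured_solution N ?u c l"
    unfolding coloured_solution_def
  proof (intro conjI ballI)
    fix g assume g: "g \<in> G"
    have "order_G * (\<Sum>j\<le>N. l j * of_bool (c j = g)) = (\<Sum>j\<le>N. x g j)"
      unfolding sum_distrib_left by (intro sum.cong) (auto simp: x_eq[OF g])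
    then show "(\<Sum>j\<le>N. l j * of_bool (c j = g)) = 1 / order_G"
      using xs(2)[OF g] order_pos by (simp add: field_simps)
  next
    fix e assume "e \<in> real_eqs"
    then obtain i h b where e: "e = (i, h, b)" "i \<in> {1..d+d'}" "h \<in> S i"
      by (auto simp: real_eqs_def)
    have "(\<Sum>j\<le>N. of_real (l j) * (?u j i * inverse (chi k r h (c j)))) = 0"
      using fourier_coeff_coloured[OF f _ x x_eq e(2), of h] c 0[OF e(2,3)] by auto
    then have "part b (\<Sum>j\<le>N. of_real (l j) * (?u j i * inverse (chi k r h (c j)))) = 0"
      by (simp add: part_simps)
    then show "(\<Sum>j\<le>N. l j * eq_coeff (?u j) (c j) e) = 0"
      by (simp add: e(1) part_simps eq_coeff_def)
  qed
  ultimately show thesis using that c by blast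
qed

theorem vanishing_family_exists:
  assumes N: "int N = int (card real_eqs) + int order_G - 1" and f: "affine_map N d d' f"
  shows "vanishing_family N f"
proof -
  let ?one = "\<one>\<^bsub>cyclic_sum k r\<^esub>"
  let ?u = "\<lambda>j i. coord d i (f (vertex j))"
  \<comment> \<open>The mass equation of the identity is dropped, because it follows from the others
    and total mass 1. This brings the number of equations down to \<open>N\<close>.\<close>
  define I where "I = real_eqs <+> (G - {?one})"
  \<comment> \<open>Subtracting \<open>1 / order_G\<close> makes the mass coefficients sum to zero
    over the colours and, as \<open>l\<close> has total mass 1, also absorbs the right-hand
    side.\<close>
  define a where "a j g = case_sum (eq_coeff (?u j) g) (\<lambda>g'. of_bool (g = g') - 1 / order_G)" for j g
  have one: "?one \<in> G" using group_cyclic_sum[where k=k and r=r, OF r] by (rule group.is_monoid[THEN monoid.one_closed])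
  have "card I = card real_eqs + (order_G - 1)"
    unfolding I_def using finite_real_eqs finite_G one by (subst card_Plus) auto
  then have card_I: "card I \<le> N" using N order_pos by linarith
  have fin_I: "finite I" unfolding I_def using finite_real_eqs finite_G by simp
  have sum_a: "(\<Sum>g\<in>G. a j g e) = 0" if "e \<in> I" for j e
  proof (cases e)
    case (Inl e')
    with that obtain i h b where e: "e' = (i, h, b)" "i \<in> {1..d+d'}" "h \<in> S i"
      by (auto simp: I_def real_eqs_def)
    have "(\<Sum>g\<in>G. a j g e) = part b (?u j i * cnj (\<Sum>g\<in>G. chi k r h g))"
      by (simp add: a_def Inl e(1) eq_coeff_def part_simps sum_distrib_left inverse_chi)
    also have "\<dots> = 0" using S[OF e(2)] e(3) by (subst sum_chi[where k=k and r=r, OF r]) (auto simp: part_simps)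
    finally show ?thesis .
  next
    case (Inr g)
    with that have "g \<in> G" by (auto simp: I_def)
    then have "(\<Sum>g'\<in>G. of_bool (g' = g)) = (1::real)"
      using finite_G by (simp add: of_bool_def sum.delta)
    then show ?thesis using order_pos by (simp add: a_def Inr sum_subtractf)
  qed
  \<comment> \<open>The values over all colours sum to zero, so they cannot all be positive.\<close>
  have C: "\<exists>g\<in>G. (\<Sum>e\<in>I. y e * a j g e) \<le> 0" for j y
  proof (rule ccontr)
    assume "\<not> ?thesis"
    then have "0 < (\<Sum>g\<in>G. \<Sum>e\<in>I. y e * a j g e)"
      using sum_pos[OF finite_G, of "\<lambda>g. \<Sum>e\<in>I. y e * a j g e"] one by (auto simp: not_le)
    also have "\<dots> = (\<Sum>e\<in>I. y e * (\<Sum>g\<in>G. a j g e))"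
      by (subst sum.swap) (simp add: sum_distrib_left)
    finally show False using sum_a by simp
  qed
  obtain c l where c: "\<And>j. j \<le> N \<Longrightarrow> c j \<in> G" and l: "l \<in> standard_simplex N"
    and eq: "\<And>e. e \<in> I \<Longrightarrow> (\<Sum>j\<le>N. l j * a j (c j) e) = 0"
    using colourful_Caratheodory[OF fin_I card_I, of "\<lambda>_. G" a] finite_G C by auto
  have sum1: "(\<Sum>j\<le>N. l j) = 1" using l by (simp add: standard_simplex_def)
  let ?mass = "\<lambda>g. \<Sum>j\<le>N. l j * of_bool (c j = g)"
  have mass: "?mass g = 1 / order_G" if "g \<in> G - {?one}" for g
  proof -
    have "0 = (\<Sum>j\<le>N. l j * a j (c j) (Inr g))" using eq[of "Inr g"] that by (auto simp: I_def)
    also have "\<dots> = ?mass g - (\<Sum>j\<le>N. l j) / order_G"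
      by (simp add: a_def right_diff_distrib sum_subtractf sum_divide_distrib)
    finally show ?thesis using sum1 by simp
  qed
  have "(\<Sum>g\<in>G. ?mass g) = (\<Sum>j\<le>N. l j * (\<Sum>g\<in>G. of_bool (c j = g)))"
    by (subst sum.swap) (simp add: sum_distrib_left)
  also have "\<dots> = (\<Sum>j\<le>N. l j)"
    using c finite_G by (intro sum.cong refl) (simp add: of_bool_def sum.delta')
  finally have "?mass ?one = 1 - (\<Sum>g\<in>G - {?one}. ?mass g)"
    using finite_G one sum1 by (simp add: sum.remove[of _ ?one])
  also have "\<dots> = 1 - (\<Sum>g\<in>G - {?one}. 1 / order_G)" using mass by simp
  also have "\<dots> = 1 / order_G"
    using finite_G one order_pos by (auto simp: card_Diff_singleton of_nat_diff diff_divide_distrib)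
  finally have "?mass g = 1 / order_G" if "g \<in> G" for g using mass that by blast
  moreover have "(\<Sum>j\<le>N. l j * eq_coeff (?u j) (c j) e) = 0" if "e \<in> real_eqs" for e
    using eq[of "Inl e"] that by (auto simp: I_def a_def)
  ultimately show ?thesis
    using vanishing_family_if_coloured_solution[OF f c l] by (simp add: coloured_solution_def)
qed

end

subsection \<open>Genericity\<close>

text \<open>Injective exponents prevent cancellation between monomials, and \<open>Suc\<close> keeps
  them positive, so subtracting \<open>s\<close> leaves the nonzero coefficient at \<open>e0\<close>
  intact.\<close>

lemma finite_sparse_polynomial_level_set:
  fixes C :: "'e \<Rightarrow> real"
  assumes E: "finite E" "inj_on \<nu> E" and e0: "e0 \<in> E" "C e0 \<noteq> 0"
  shows "finite {t. (\<Sum>e\<in>E. C e * t ^ Suc (\<nu> e)) = s}"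
proof -
  define p where "p = (\<Sum>e\<in>E. Polynomial.monom (C e) (Suc (\<nu> e))) - [:s:]"
  have "Polynomial.coeff p (Suc (\<nu> e0)) = (\<Sum>e\<in>E. if e = e0 then C e else 0)"
    using E(2) e0(1) by (auto simp: p_def coeff_sum inj_on_eq_iff intro!: sum.cong)
  then have "Polynomial.coeff p (Suc (\<nu> e0)) \<noteq> 0" using E(1) e0 by simp
  then have "p \<noteq> 0" by auto
  moreover have "poly p t = (\<Sum>e\<in>E. C e * t ^ Suc (\<nu> e)) - s" for t
    by (simp add: p_def poly_sum poly_monom)
  ultimately show ?thesis using poly_roots_finite[of p] by simp
qed

context fourier_constraints
begin

text \<open>A variant of the moment curve: with \<open>\<nu>\<close> injective, every real
  coordinate of every colour gets its own power of t.\<close>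

definition curve :: "((nat \<Rightarrow> int) \<times> nat \<times> bool \<Rightarrow> nat) \<Rightarrow> real \<Rightarrow> (nat \<Rightarrow> int) \<Rightarrow> nat \<Rightarrow> complex" where
  "curve \<nu> t g i = Complex (t ^ Suc (\<nu> (g, i, False))) (t ^ Suc (\<nu> (g, i, True)))"

definition target_curve :: "((nat \<Rightarrow> int) \<times> nat \<times> bool \<Rightarrow> nat) \<Rightarrow> real \<Rightarrow> (nat \<Rightarrow> int) \<Rightarrow> nat \<Rightarrow> complex" where
  "target_curve \<nu> t g i = (if i \<le> d then curve \<nu> t g i else of_real (Re (curve \<nu> t g i)))"

text \<open>The minus sign makes the real part of z times this number equal to \<mu>(i, h, False) Re
  z + \<mu>(i, h, True) Im z, with the second term omitted when that equation is absent.\<close>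

definition dual_coeff :: "(nat \<times> (nat \<Rightarrow> int) \<times> bool \<Rightarrow> real) \<Rightarrow> nat \<Rightarrow> (nat \<Rightarrow> int) \<Rightarrow> complex" where
  "dual_coeff \<mu> i h = Complex (\<mu> (i, h, False)) (if (i, h, True) \<in> real_eqs then - \<mu> (i, h, True) else 0)"

text \<open>The adjoint of the system: it records how the combination of equations with weights
  \<mu> responds to moving coordinate \<open>i\<close> of a vertex of colour
  \<open>g\<close>.\<close>

definition dual_fun :: "(nat \<times> (nat \<Rightarrow> int) \<times> bool \<Rightarrow> real) \<Rightarrow> nat \<Rightarrow> (nat \<Rightarrow> int) \<Rightarrow> complex" where
  "dual_fun \<mu> i g = (\<Sum>h\<in>S i. dual_coeff \<mu> i h * inverse (chi k r h g))"

lemma sum_eq_coeff_eq_dual_fun: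
  "(\<Sum>e\<in>real_eqs. \<mu> e * eq_coeff u g e) = (\<Sum>i=1..d+d'. Re (u i * dual_fun \<mu> i g))"
proof -
  let ?B = "\<lambda>i h. if d < i \<and> h \<in> T i then {False} else UNIV"
  have "(\<Sum>e\<in>real_eqs. \<mu> e * eq_coeff u g e) =
      (\<Sum>i=1..d+d'. \<Sum>y\<in>(SIGMA h:S i. ?B i h). \<mu> (i, y) * eq_coeff u g (i, y))"
    unfolding real_eqs_def by (subst sum.Sigma) (auto intro!: finite_SigmaI finite_S)
  also have "\<dots> = (\<Sum>i=1..d+d'. \<Sum>h\<in>S i. \<Sum>b\<in>?B i h. \<mu> (i, h, b) * eq_coeff u g (i, h, b))"
    by (intro sum.cong refl, subst sum.Sigma) (auto intro!: finite_S)
  also have "\<dots> = (\<Sum>i=1..d+d'. \<Sum>h\<in>S i. Re (u i * (dual_coeff \<mu> i h * inverse (chi k r h g))))"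
  proof (intro sum.cong refl)
    fix i h assume "i \<in> {1..d+d'}" "h \<in> S i"
    then show "(\<Sum>b\<in>?B i h. \<mu> (i, h, b) * eq_coeff u g (i, h, b)) =
        Re (u i * (dual_coeff \<mu> i h * inverse (chi k r h g)))"
      by (simp add: real_eqs_def dual_coeff_def UNIV_bool eq_coeff_def part_def algebra_simps
          del: inverse_complex.sel)
  qed
  also have "\<dots> = (\<Sum>i=1..d+d'. Re (u i * dual_fun \<mu> i g))"
    by (simp add: dual_fun_def sum_distrib_left)
  finally show ?thesis .
qed

text \<open>Linear independence of characters settles complex coordinates. A real coordinate sees
  only the real part of \<open>dual_fun\<close>, and there the assumption \<open>S_T\<close> rules
  out cancellation between conjugate characters.\<close>

lemma dual_fun_nontrivial:
  assumes "e \<in> real_eqs" "\<mu> e \<noteq> 0"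
  obtains i g where "i \<in> {1..d+d'}" "g \<in> G"
    "Re (dual_fun \<mu> i g) \<noteq> 0 \<or> i \<le> d \<and> Im (dual_fun \<mu> i g) \<noteq> 0"
proof -
  obtain i h b where e: "e = (i, h, b)" "i \<in> {1..d+d'}" "h \<in> S i"
    using assms(1) by (auto simp: real_eqs_def)
  have SG: "S i \<subseteq> G" using S[OF e(2)] by blast
  have coeff: "dual_coeff \<mu> i h \<noteq> 0"
    using assms e(1) by (cases b) (auto simp: dual_coeff_def complex_eq_iff)
  have "\<exists>g\<in>G. Re (dual_fun \<mu> i g) \<noteq> 0 \<or> i \<le> d \<and> Im (dual_fun \<mu> i g) \<noteq> 0"
  proof (cases "i \<le> d")
    case True
    obtain g where "g \<in> G" "dual_fun \<mu> i g \<noteq> 0"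
      using chi_combination_eq_0[where k=k and r=r, OF r SG e(3), of "dual_coeff \<mu> i"] coeff
      unfolding dual_fun_def by blast
    with True show ?thesis by (auto simp: complex_eq_iff)
  next
    case False
    \<comment> \<open>If the inverse of \<open>h\<close> also lies in \<open>S i\<close>, then
      \<open>h\<close> has order 2. So it is its own inverse, and its imaginary equation is absent,
      which makes \<open>dual_coeff\<close> real.\<close>
    have "inv\<^bsub>cyclic_sum k r\<^esub> h = h \<and> Im (dual_coeff \<mu> i h) = 0" if "inv\<^bsub>cyclic_sum k r\<^esub> h \<in> S i"
    proof -
      have "h \<in> T i" using S_T[of i h] that False e by auto
      with False e T[of i] have "group.ord (cyclic_sum k r) h = 2" by simp
      with False e SG \<open>h \<in> T i\<close> show ?thesis
        using inv_eq_self_of_ord_2[where k=k and r=r, OF r] by (auto simp: dual_coeff_def real_eqs_def)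
    qed
    from Re_chi_combination_eq_0[where k=k and r=r, OF r SG e(3), of "dual_coeff \<mu> i", OF _ this]
    show ?thesis using coeff unfolding dual_fun_def by blast
  qed
  with that e(2) show thesis by blast
qed

lemma finite_curve_level_set:
  assumes \<nu>: "inj_on \<nu> (G \<times> {1..d+d'} \<times> UNIV)" and "e0 \<in> real_eqs" "\<mu> e0 \<noteq> 0"
  shows "finite {t. (\<Sum>g\<in>G. \<Sum>e\<in>real_eqs. \<mu> e * eq_coeff (target_curve \<nu> t g) g e) = s}"
proof -
  define E :: "((nat \<Rightarrow> int) \<times> nat \<times> bool) set" where "E = G \<times> {1..d+d'} \<times> UNIV"
  \<comment> \<open>These are the real components of the pairing Re(u * \<open>dual_fun\<close>):
    the imaginary part of u enters with a minus sign, and not at all in a real coordinate.\<close>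
  define C where "C = (\<lambda>(g, i, b). if b then (if i \<le> d then - Im (dual_fun \<mu> i g) else 0)
    else Re (dual_fun \<mu> i g))"
  obtain i g where "i \<in> {1..d+d'}" "g \<in> G"
    "Re (dual_fun \<mu> i g) \<noteq> 0 \<or> i \<le> d \<and> Im (dual_fun \<mu> i g) \<noteq> 0"
    using dual_fun_nontrivial[where \<mu>=\<mu>] assms(2,3) by blast
  then have "(g, i, False) \<in> E \<and> C (g, i, False) \<noteq> 0 \<or> (g, i, True) \<in> E \<and> C (g, i, True) \<noteq> 0"
    by (auto simp: E_def C_def)
  then obtain e where "e \<in> E" "C e \<noteq> 0" by blast
  moreover have "finite E" using finite_G by (simp add: E_def)
  moreover have "inj_on \<nu> E" using \<nu> by (simp add: E_def)
  ultimately have "finite {t. (\<Sum>e\<in>E. C e * t ^ Suc (\<nu> e)) = s}"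
    by (intro finite_sparse_polynomial_level_set)
  moreover have "(\<Sum>g\<in>G. \<Sum>e\<in>real_eqs. \<mu> e * eq_coeff (target_curve \<nu> t g) g e) =
      (\<Sum>e\<in>E. C e * t ^ Suc (\<nu> e))" for t
  proof -
    have "(\<Sum>e\<in>E. C e * t ^ Suc (\<nu> e)) =
        (\<Sum>g\<in>G. \<Sum>i=1..d+d'. \<Sum>b\<in>UNIV. C (g, i, b) * t ^ Suc (\<nu> (g, i, b)))"
      unfolding E_def by (simp only: sum.cartesian_product split_def prod.collapse)
    also have "\<dots> = (\<Sum>g\<in>G. \<Sum>i=1..d+d'. Re (target_curve \<nu> t g i * dual_fun \<mu> i g))"
      by (intro sum.cong refl) (simp add: UNIV_bool C_def target_curve_def curve_def algebra_simps)
    finally show ?thesis by (simp add: sum_eq_coeff_eq_dual_fun)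
  qed
  ultimately show ?thesis by simp
qed

text \<open>
  There are more equations than unknowns, so some combination \<open>x\<close> of their left-hand sides
  vanishes identically in \<open>l\<close>. Moving all vertices of colour \<open>g\<close> by \<open>target_curve \<nu> t g\<close> adds to it
  a quantity that does not depend on \<open>l\<close>, as each colour class has mass \<open>1 / order_G\<close>: a
  non-constant polynomial in \<open>t\<close>, since characters are linearly independent. (If \<open>x\<close> involves
  only the mass equations, some colour is unused and there is no solution at all.)
\<close>

lemma finite_coloured_solution_parameters:
  assumes N: "int N < int (card real_eqs) + int order_G - 1"
    and c: "c \<in> {..N} \<rightarrow> G" and \<nu>: "inj_on \<nu> (G \<times> {1..d+d'} \<times> UNIV)"
  shows "finite {t. \<exists>l. coloured_solution N (\<lambda>j i. u j i + target_curve \<nu> t (c j) i) c l}"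
proof -
  define J where "J = real_eqs <+> G"
  define A where "A j = case_sum (eq_coeff (u j) (c j)) (\<lambda>g. of_bool (c j = g))" for j
  \<comment> \<open>The system is used transposed: the unknowns are multipliers of the equations in
    \<open>J\<close>, with one condition for each of the \<open>N\<close> + 1 vertices.\<close>
  have "finite J" "card {..N} < card J"
    using N finite_real_eqs finite_G by (auto simp: J_def card_Plus)
  then obtain x where x: "\<exists>e\<in>J. x e \<noteq> 0" "\<And>j. j \<in> {..N} \<Longrightarrow> (\<Sum>e\<in>J. A j e * x e) = 0"
    using homogeneous_system_nontrivial_solution[of "{..N}" J A] by blast
  define \<mu> \<rho> where "\<mu> e = x (Inl e)" and "\<rho> g = x (Inr g)" for e g
  have rel: "(\<Sum>e\<in>real_eqs. \<mu> e * eq_coeff (u j) (c j) e) + \<rho> (c j) = 0" if "j \<le> N" for j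
  proof -
    have "(\<Sum>g\<in>G. of_bool (c j = g) * \<rho> g) = \<rho> (c j)"
      using c that finite_G by (auto simp: of_bool_def if_distrib[of "\<lambda>z. z * _"] sum.delta' cong: if_cong)
    then show ?thesis
      using x(2)[of j] that finite_real_eqs finite_G
      by (simp add: J_def sum.Plus A_def \<mu>_def \<rho>_def mult.commute)
  qed
  let ?q = "\<lambda>t g e. eq_coeff (target_curve \<nu> t g) g e"
  let ?bad = "{t. \<exists>l. coloured_solution N (\<lambda>j i. u j i + target_curve \<nu> t (c j) i) c l}"
  have bad: "(\<Sum>g\<in>G. \<Sum>e\<in>real_eqs. \<mu> e * ?q t g e) = (\<Sum>g\<in>G. \<rho> g)"
    and onto: "G \<subseteq> c ` {..N}" if "t \<in> ?bad" for t
  proof -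
    from that obtain l where mass: "\<And>g. g \<in> G \<Longrightarrow> (\<Sum>j\<le>N. l j * of_bool (c j = g)) = 1 / order_G"
      and eqs: "\<And>e. e \<in> real_eqs \<Longrightarrow>
        (\<Sum>j\<le>N. l j * eq_coeff (\<lambda>i. u j i + target_curve \<nu> t (c j) i) (c j) e) = 0"
      unfolding coloured_solution_def by blast
    show "G \<subseteq> c ` {..N}"
    proof
      fix g assume g: "g \<in> G"
      show "g \<in> c ` {..N}"
      proof (rule ccontr)
        assume "g \<notin> c ` {..N}"
        then have "(\<Sum>j\<le>N. l j * of_bool (c j = g)) = 0" by (intro sum.neutral) auto
        with mass[OF g] order_pos show False by simp
      qed
    qed
    \<comment> \<open>Equal class masses turn the \<open>l\<close>-average of any function of the
      colour into its uniform mean over the group, which eliminates \<open>l\<close>.\<close>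
    have by_colour: "(\<Sum>j\<le>N. l j * F (c j)) = (\<Sum>g\<in>G. F g) / order_G" for F :: "(nat \<Rightarrow> int) \<Rightarrow> real"
    proof -
      have "(\<Sum>j\<le>N. l j * F (c j)) = (\<Sum>j\<le>N. \<Sum>g\<in>G. l j * of_bool (c j = g) * F g)"
        using c finite_G
        by (intro sum.cong refl) (auto simp: of_bool_def if_distrib[of "\<lambda>z. _ * z * _"] sum.delta' cong: if_cong)
      also have "\<dots> = (\<Sum>g\<in>G. (\<Sum>j\<le>N. l j * of_bool (c j = g)) * F g)"
        unfolding sum_distrib_right by (rule sum.swap)
      finally show ?thesis using mass by (simp add: sum_divide_distrib)
    qed
    have split: "eq_coeff (\<lambda>i. u j i + target_curve \<nu> t (c j) i) (c j) e =
        eq_coeff (u j) (c j) e + ?q t (c j) e" for j e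
      by (cases e) (simp add: eq_coeff_def part_simps distrib_right)
    have "0 = (\<Sum>e\<in>real_eqs. \<mu> e *
        (\<Sum>j\<le>N. l j * eq_coeff (\<lambda>i. u j i + target_curve \<nu> t (c j) i) (c j) e))"
      using eqs by simp
    also have "\<dots> = (\<Sum>j\<le>N. l j * ((\<Sum>e\<in>real_eqs. \<mu> e * eq_coeff (u j) (c j) e) +
        (\<Sum>e\<in>real_eqs. \<mu> e * ?q t (c j) e)))"
      unfolding sum_distrib_left split sum.distrib[symmetric]
      by (subst sum.swap) (simp add: algebra_simps)
    also have "\<dots> = (\<Sum>j\<le>N. l j * ((\<Sum>e\<in>real_eqs. \<mu> e * ?q t (c j) e) - \<rho> (c j)))"
      using rel by (intro sum.cong refl) (simp add: eq_neg_iff_add_eq_0[symmetric])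
    also have "\<dots> = (\<Sum>g\<in>G. (\<Sum>e\<in>real_eqs. \<mu> e * ?q t g e) - \<rho> g) / order_G"
      by (rule by_colour)
    finally show "(\<Sum>g\<in>G. \<Sum>e\<in>real_eqs. \<mu> e * ?q t g e) = (\<Sum>g\<in>G. \<rho> g)"
      using order_pos by (simp add: sum_subtractf)
  qed
  show ?thesis
  proof (cases "\<exists>e\<in>real_eqs. \<mu> e \<noteq> 0")
    case True
    then have "finite {t. (\<Sum>g\<in>G. \<Sum>e\<in>real_eqs. \<mu> e * ?q t g e) = (\<Sum>g\<in>G. \<rho> g)}"
      using finite_curve_level_set[OF \<nu>] by blast
    then show ?thesis by (rule rev_finite_subset) (use bad in blast)
  next
    case False
    then have \<rho>: "\<rho> (c j) = 0" if "j \<le> N" for j using rel[OF that] by simp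
    obtain g where "g \<in> G" "\<rho> g \<noteq> 0"
      using x(1) False by (auto simp: J_def \<mu>_def \<rho>_def)
    with \<rho> have "\<not> G \<subseteq> c ` {..N}" by auto
    then have "?bad = {}" using onto by blast
    then show ?thesis by simp
  qed
qed

lemma coloured_solution_cong:
  assumes "\<And>j i. j \<le> N \<Longrightarrow> i \<in> {1..d+d'} \<Longrightarrow> u j i = u' j i"
  shows "coloured_solution N u c l \<longleftrightarrow> coloured_solution N u' c l"
proof -
  have "eq_coeff (u j) (c j) e = eq_coeff (u' j) (c j) e" if "j \<le> N" "e \<in> real_eqs" for j e
    using assms that by (auto simp: eq_coeff_def real_eqs_def)
  then show ?thesis unfolding coloured_solution_def
    by (intro conj_cong ball_cong refl arg_cong2[where f = "(=)"] sum.cong) auto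
qed

section \<open>The null set of vertex images admitting a solution\<close>

definition bad_vertex_images :: "nat \<Rightarrow> (nat \<Rightarrow> nat \<Rightarrow> int) \<Rightarrow> (nat \<Rightarrow> cvec_rvec) set" where
  "bad_vertex_images N c = {v \<in> space (vertex_images_measure N d d').
     \<exists>l\<in>standard_simplex N. coloured_solution N (\<lambda>j i. coord d i (v j)) c l}"

lemma sets_bad_vertex_images: "bad_vertex_images N c \<in> sets (vertex_images_measure N d d')"
proof -
  let ?M = "vertex_images_measure N d d'"
  \<comment> \<open>A sum of squares encodes the whole system as a single zero of a nonnegative
    function, continuous in \<open>l\<close> and measurable in \<open>v\<close>.\<close>
  define F where "F v l = (\<Sum>g\<in>G. ((\<Sum>j\<le>N. l j * of_bool (c j = g)) - 1 / order_G)\<^sup>2) +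
    (\<Sum>e\<in>real_eqs. (\<Sum>j\<le>N. l j * eq_coeff (\<lambda>i. coord d i (v j)) (c j) e)\<^sup>2)"
    for v :: "nat \<Rightarrow> cvec_rvec" and l :: "nat \<Rightarrow> real"
  have F: "coloured_solution N (\<lambda>j i. coord d i (v j)) c l \<longleftrightarrow> F v l = 0" for v l
    unfolding F_def coloured_solution_def using finite_G finite_real_eqs
    by (subst add_nonneg_eq_0_iff) (auto simp: sum_nonneg_eq_0_iff intro!: sum_nonneg)
  have coeff: "(\<lambda>v. eq_coeff (\<lambda>i. coord d i (v j)) (c j) e) \<in> borel_measurable ?M"
    if "e \<in> real_eqs" "j \<in> {..N}" for e j
  proof -
    from that obtain i h b where e: "e = (i, h, b)" "i \<in> {1..d+d'}" by (auto simp: real_eqs_def)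
    have [measurable]: "(\<lambda>v. coord d i (v j)) \<in> borel_measurable ?M"
      using borel_measurable_coord_vertex_images that(2) e(2) by simp
    show ?thesis unfolding e(1) eq_coeff_def part_def by (cases b) simp_all
  qed
  have "{v \<in> space ?M. \<exists>l\<in>standard_simplex N. F v l = 0} \<in> sets ?M"
  proof (rule sets_exists_zero_compact[OF compact_standard_simplex])
    show "(\<lambda>v. F v l) \<in> borel_measurable ?M" for l
      unfolding F_def using coeff by measurable
    show "continuous_on (standard_simplex N) (F v)" for v
      unfolding F_def
      by (intro continuous_intros continuous_on_subset[OF continuous_on_product_coordinates]) auto
    show "F v l \<ge> 0" for v l unfolding F_def by (intro add_nonneg_nonneg sum_nonneg) auto
  qed
  then show ?thesis unfolding bad_vertex_images_def F .
qed

lemma null_bad_vertex_images: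
  assumes N: "int N < int (card real_eqs) + int order_G - 1" and c: "c \<in> {..N} \<rightarrow> G"
  shows "bad_vertex_images N c \<in> null_sets (vertex_images_measure N d d')"
proof -
  obtain \<nu> :: "(nat \<Rightarrow> int) \<times> nat \<times> bool \<Rightarrow> nat" where \<nu>: "inj_on \<nu> (G \<times> {1..d+d'} \<times> UNIV)"
    using finite_imp_inj_to_nat_seg[of "G \<times> {1..d+d'} \<times> (UNIV :: bool set)"] finite_G by auto
  \<comment> \<open>The displacement of vertex \<open>j\<close> depends only on its colour
    \<open>c j\<close>, so each class moves rigidly.\<close>
  define \<tau> where "\<tau> t = vertex_shift N d d' (\<lambda>j. curve \<nu> t (c j))" for t
  show ?thesis
  proof (rule null_set_if_finite_translates[where \<tau> = \<tau>])
    have "(\<lambda>t. curve \<nu> t g i) \<in> borel_measurable borel" for g i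
      unfolding curve_def Complex_eq by (intro borel_measurable_continuous_onI continuous_intros)
    then show "case_prod \<tau> \<in> measurable (lborel \<Otimes>\<^sub>M vertex_images_measure N d d') (vertex_images_measure N d d')"
      unfolding \<tau>_def by (intro measurable_vertex_shift)
    show "finite {t. \<tau> t v \<in> bad_vertex_images N c}" for v
    proof (rule finite_subset[OF _ finite_coloured_solution_parameters[OF N c \<nu>, of "\<lambda>j i. coord d i (v j)"]], rule subsetI)
      fix t assume "t \<in> {t. \<tau> t v \<in> bad_vertex_images N c}"
      then obtain l where "coloured_solution N (\<lambda>j i. coord d i (\<tau> t v j)) c l"
        by (auto simp: bad_vertex_images_def)
      then have "coloured_solution N (\<lambda>j i. coord d i (v j) + target_curve \<nu> t (c j) i) c l"
        by (subst (asm) coloured_solution_cong) (auto simp: \<tau>_def coord_vertex_shift target_curve_def)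
      then show "t \<in> {t. \<exists>l. coloured_solution N (\<lambda>j i. coord d i (v j) + target_curve \<nu> t (c j) i) c l}"
        by blast
    qed
  qed (auto simp: \<tau>_def distr_vertex_shift sets_bad_vertex_images sigma_finite_vertex_images_measure)
qed

theorem almost_no_vanishing_family:
  assumes N: "int N < int (card real_eqs) + int order_G - 1"
  shows "for_almost_any_affine_map N d d' (\<lambda>f. \<not> vanishing_family N f)"
proof -
  let ?B = "\<Union>c\<in>{..N} \<rightarrow>\<^sub>E G. bad_vertex_images N c"
  have "?B \<in> null_sets (vertex_images_measure N d d')"
    using null_bad_vertex_images[OF N] finite_G
    by (intro null_sets_UN' countable_finite finite_PiE) auto
  then have "AE v in vertex_images_measure N d d'. v \<notin> ?B"
    by (rule AE_not_in)
  then show ?thesis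
    unfolding for_almost_any_affine_map_def
  proof (rule AE_mp, intro AE_I2 impI allI notI)
    fix v f assume v: "v \<in> space (vertex_images_measure N d d')" "v \<notin> ?B"
      and f: "affine_map N d d' f \<and> (\<forall>j\<le>N. f (vertex j) = v j)" and "vanishing_family N f"
    then obtain c l where "c \<in> {..N} \<rightarrow>\<^sub>E G" "l \<in> standard_simplex N"
      "coloured_solution N (\<lambda>j i. coord d i (f (vertex j))) c l"
      using coloured_solution_if_vanishing_family by blast
    with f v show False
      by (subst (asm) coloured_solution_cong[where u' = "\<lambda>j i. coord d i (v j)"])
        (auto simp: bad_vertex_images_def)
  qed
qed

end

theorem theorem3p1:
  fixes d d' k N m m' :: nat
    and r :: "nat \<Rightarrow> nat"
    and G :: "(nat \<Rightarrow> int) monoid"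
    and S T :: "nat \<Rightarrow> (nat \<Rightarrow> int) set"
  assumes dim: "d + d' \<ge> 1"
    and k: "k \<ge> 1"
    and r: "\<And>j. j \<in> {1..k} \<Longrightarrow> r j \<ge> 2"
    and G: "G = cyclic_sum k r"
    and S: "\<And>i. i \<in> {1..d+d'} \<Longrightarrow> S i \<subseteq> carrier G - {\<one>\<^bsub>G\<^esub>}"
    and T: "\<And>i. i \<in> {d+1..d+d'} \<Longrightarrow> T i = {h \<in> S i. group.ord G h = 2}"
    and S_T: "\<And>i h. i \<in> {d+1..d+d'} \<Longrightarrow> h \<in> S i - T i \<Longrightarrow> inv\<^bsub>G\<^esub> h \<notin> S i"
    and m: "m = (\<Sum>i=1..d+d'. card (S i))"
    and m': "m' = (\<Sum>i=d+1..d+d'. card (T i))"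
  shows "(int N = 2 * int m - int m' + int (\<Prod>j=1..k. r j) - 1 \<longrightarrow>
           (\<forall>f. affine_map N d d' f \<longrightarrow>
              (\<exists>x. (\<forall>g\<in>carrier G. x g \<in> standard_simplex N) \<and>
                   pairwise_disjoint_support N (carrier G) x \<and>
                   (\<forall>i\<in>{1..d+d'}. \<forall>h\<in>S i. fourier_coeff d k r f x i h = 0)))) \<and>
         (int N < 2 * int m - int m' + int (\<Prod>j=1..k. r j) - 1 \<longrightarrow>
           for_almost_any_affine_map N d d' (\<lambda>f.
              \<not> (\<exists>x. (\<forall>g\<in>carrier G. x g \<in> standard_simplex N) \<and>
                      pairwise_disjoint_support N (carrier G) x \<and>
                      (\<forall>i\<in>{1..d+d'}. \<forall>h\<in>S i. fourier_coeff d k r f x i h = 0))))"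
proof -
  have r': "r j > 0" if "j \<in> {1..k}" for j using r[OF that] by simp
  interpret fourier_constraints d d' k r S T
    using r' S T S_T unfolding G by unfold_locales
  have dims: "2 * int m - int m' + int (\<Prod>j=1..k. r j) - 1 = int (card real_eqs) + int order_G - 1"
    unfolding card_real_eqs m m' using card_cyclic_sum[of k r] r' by simp
  show ?thesis
    unfolding G dims
    using vanishing_family_exists[of N] almost_no_vanishing_family[of N]
    unfolding vanishing_family_def by blast
qed
end
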